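(* Let $k$ be a field, $S=k[x_1,\ldots,x_n]$, and let $I\subsetneq S$ be a nonzero squarefree monomial ideal. If the $S$-module $I/I^2$ is Cohen--Macaulay, then $I^2=I^{(2)}$. In particular, $I/I^{(2)}$ is then Cohen--Macaulay.
   Context: For a squarefree monomial ideal $I$, the $t$-th symbolic power is $I^{(t)}=\bigcap_{P\in\operatorname{Min}(I)}P^t$, the intersection over the minimal primes of $I$. A finitely generated graded $S$-module $M\ne 0$ is Cohen--Macaulay if $\operatorname{depth} M=\dim M$ (depth with respect to $(x_1,\ldots,x_n)$). *)

theory Defs
  imports
    "HOL-Library.Poly_Mapping"
    "HOL-Library.Extended_Nat"
    "HOL-Algebra.Algebra"
    "HOL-Algebra.Algebraic_Closure_Type"
begin

section \<open>Ideals of a commutative ring\<close>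

text \<open>The zeroth power of an ideal is the whole ring; note that
  \<^term>\<open>ideal_prod R I J\<close> consists of all finite sums of products.\<close>

abbreviation ideal_pow :: "('a, 'b) ring_scheme \<Rightarrow> 'a set \<Rightarrow> nat \<Rightarrow> 'a set" where
  "ideal_pow R I t \<equiv> I [^]\<^bsub>ideals_set R\<^esub> t"

definition minimal_primes :: "('a, 'b) ring_scheme \<Rightarrow> 'a set \<Rightarrow> 'a set set" where
  "minimal_primes R I =
     {P. primeideal P R \<and> I \<subseteq> P \<and> (\<forall>Q. primeideal Q R \<and> I \<subseteq> Q \<and> Q \<subseteq> P \<longrightarrow> Q = P)}"

text \<open>For an arbitrary ideal symbolic powers are defined through localizations; the
  formula below is the one for squarefree monomial ideals. The intersection with the carrier
  only makes the definition sensible when there are no minimal primes.\<close>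

definition symbolic_power :: "('a, 'b) ring_scheme \<Rightarrow> 'a set \<Rightarrow> nat \<Rightarrow> 'a set" where
  "symbolic_power R I t = carrier R \<inter> (\<Inter>P \<in> minimal_primes R I. ideal_pow R P t)"

text \<open>A chain \<open>P\<^sub>0 \<subset> \<dots> \<subset> P\<^sub>r\<close> of prime ideals is a list of length \<open>r + 1\<close>. The zero ring
  gets dimension \<open>0\<close>, the supremum of the empty set in \<^typ>\<open>enat\<close>.\<close>

definition krull_dim :: "('a, 'b) ring_scheme \<Rightarrow> enat" where
  "krull_dim R =
     (SUP Ps \<in> {Ps. Ps \<noteq> [] \<and> (\<forall>P \<in> set Ps. primeideal P R) \<and> sorted_wrt (\<subset>) Ps}.
        enat (length Ps - 1))"


section \<open>Modules\<close>

text \<open>An ideal \<open>I\<close> of \<open>R\<close>, regarded as an \<open>R\<close>-module.\<close>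

definition ideal_module :: "('a, 'b) ring_scheme \<Rightarrow> 'a set \<Rightarrow> ('a, 'a) module" where
  "ideal_module R I =
     \<lparr>carrier = I, monoid.mult = monoid.mult R, monoid.one = \<one>\<^bsub>R\<^esub>, ring.zero = \<zero>\<^bsub>R\<^esub>,
      ring.add = ring.add R, module.smult = monoid.mult R\<rparr>"

text \<open>The quotient by a submodule. The fields \<^const>\<open>monoid.mult\<close> and \<^const>\<open>monoid.one\<close> are present
  in every module record but have no meaning for a module.\<close>

definition quotient_module :: "('a, 'b, 'c) module_scheme \<Rightarrow> 'b set \<Rightarrow> ('a, 'b set) module" where
  "quotient_module M N =
     \<lparr>carrier = a_rcosets\<^bsub>M\<^esub> N,
      monoid.mult = undefined, monoid.one = undefined, ring.zero = N,
      ring.add = set_add M, module.smult = (\<lambda>a C. \<Union>x\<in>C. N +>\<^bsub>M\<^esub> (a \<odot>\<^bsub>M\<^esub> x))\<rparr>"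

definition annihilator ::
    "('a, 'r) ring_scheme \<Rightarrow> ('a, 'b, 'c) module_scheme \<Rightarrow> 'a set" where
  "annihilator R M = {a \<in> carrier R. \<forall>x \<in> carrier M. a \<odot>\<^bsub>M\<^esub> x = \<zero>\<^bsub>M\<^esub>}"

definition module_dim ::
    "('a, 'r) ring_scheme \<Rightarrow> ('a, 'b, 'c) module_scheme \<Rightarrow> enat" where
  "module_dim R M = krull_dim (R Quot annihilator R M)"

text \<open>The submodule \<open>(f\<^sub>1, \<dots>, f\<^sub>r) M\<close>.\<close>

definition list_times_module :: "'a list \<Rightarrow> ('a, 'b, 'c) module_scheme \<Rightarrow> 'b set" where
  "list_times_module fs M =
     {\<Oplus>\<^bsub>M\<^esub>i\<in>{..<length fs}. (fs ! i) \<odot>\<^bsub>M\<^esub> x i | x. x \<in> {..<length fs} \<rightarrow> carrier M}"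

definition nonzerodivisor_on :: "'a \<Rightarrow> ('a, 'b, 'c) module_scheme \<Rightarrow> bool" where
  "nonzerodivisor_on a M \<longleftrightarrow> (\<forall>x \<in> carrier M. a \<odot>\<^bsub>M\<^esub> x = \<zero>\<^bsub>M\<^esub> \<longrightarrow> x = \<zero>\<^bsub>M\<^esub>)"

text \<open>An \<open>M\<close>-regular sequence \<open>f\<^sub>1, \<dots>, f\<^sub>r\<close>: each \<open>f\<^sub>i\<close> is a nonzerodivisor on
  \<open>M / (f\<^sub>1, \<dots>, f\<^bsub>i-1\<^esub>) M\<close>, and \<open>M / (f\<^sub>1, \<dots>, f\<^sub>r) M\<close> is nonzero.\<close>

definition regular_sequence :: "'a list \<Rightarrow> ('a, 'b, 'c) module_scheme \<Rightarrow> bool" where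
  "regular_sequence fs M \<longleftrightarrow>
     (\<forall>i < length fs.
        nonzerodivisor_on (fs ! i) (quotient_module M (list_times_module (take i fs) M))) \<and>
     list_times_module fs M \<noteq> carrier M"

definition depth :: "'a set \<Rightarrow> ('a, 'b, 'c) module_scheme \<Rightarrow> enat" where
  "depth \<aa> M = (SUP fs \<in> {fs. set fs \<subseteq> \<aa> \<and> regular_sequence fs M}. enat (length fs))"


section \<open>Polynomial rings\<close>

text \<open>Polynomials over \<^typ>\<open>'k\<close> in variables indexed by \<^typ>\<open>'n\<close>: finitely supported
  coefficient functions on exponent vectors.\<close>

type_synonym ('n, 'k) mpoly = "('n \<Rightarrow>\<^sub>0 nat) \<Rightarrow>\<^sub>0 'k"

abbreviation mpoly_ring :: "('n::finite, 'k::field) mpoly ring" where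
  "mpoly_ring \<equiv> ring_of_type_algebra"

definition monomial :: "('n::finite \<Rightarrow>\<^sub>0 nat) \<Rightarrow> ('n, 'k::field) mpoly" where
  "monomial m = Poly_Mapping.single m 1"

definition variable :: "'n::finite \<Rightarrow> ('n, 'k::field) mpoly" where
  "variable i = monomial (Poly_Mapping.single i 1)"

definition irrelevant_ideal :: "('n::finite, 'k::field) mpoly set" where
  "irrelevant_ideal = Idl\<^bsub>mpoly_ring\<^esub> (range variable)"

definition squarefree_monomial_ideal :: "('n::finite, 'k::field) mpoly set \<Rightarrow> bool" where
  "squarefree_monomial_ideal I \<longleftrightarrow>
     (\<exists>E. (\<forall>m \<in> E. \<forall>i. Poly_Mapping.lookup m i \<le> 1) \<and> I = Idl\<^bsub>mpoly_ring\<^esub> (monomial ` E))"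

text \<open>The notion is used for finitely generated graded modules only; \<open>I / J\<close> with
  homogeneous ideals \<open>J \<subseteq> I\<close> is always of this kind.\<close>

definition cohen_macaulay :: "(('n::finite, 'k::field) mpoly, 'b) module \<Rightarrow> bool" where
  "cohen_macaulay M \<longleftrightarrow>
     module mpoly_ring M \<and> carrier M \<noteq> {\<zero>\<^bsub>M\<^esub>} \<and>
     depth irrelevant_ideal M = module_dim mpoly_ring M"

end

theory Submission
  imports Defs
begin

text \<open>
  Suppose that \<open>I\<^sup>2 \<noteq> I\<^bsup>(2)\<^esup>\<close>. A monomial \<open>w\<close> of \<open>I\<^bsup>(2)\<^esup>\<close> outside \<open>I\<^sup>2\<close> whose annihilator modulo
  \<open>I\<^sup>2\<close> contains as many variables as possible is killed by a monomial prime \<open>P\<^sub>A\<close> that is not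
  minimal over \<open>I\<close>, that is, \<open>A\<close> properly contains \<open>B\<close> for some minimal prime \<open>P\<^sub>B\<close> of \<open>I\<close>.
  The dimension of \<open>I/I\<^sup>2\<close> is at least \<open>n - |B|\<close>, because \<open>P\<^sub>B\<close> contains its annihilator. Its
  depth is at most \<open>n - |A|\<close>: starting from \<open>w\<close>, an \<open>I/I\<^sup>2\<close>-regular sequence \<open>f\<^sub>1, \<dots>, f\<^sub>r\<close> gives
  an increasing chain of annihilators \<open>\<aa>\<^sub>0 \<supseteq> P\<^sub>A\<close>, \<open>\<aa>\<^sub>1\<close>, \<open>\<dots>\<close>, \<open>\<aa>\<^sub>r\<close> inside the irrelevant ideal with
  \<open>f\<^sub>i\<^sub>+\<^sub>1 \<in> \<aa>\<^sub>i\<^sub>+\<^sub>1\<close> regular modulo \<open>\<aa>\<^sub>i\<close>. Hence \<open>f\<^sub>1, \<dots>, f\<^sub>r\<close> are algebraically independent modulo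
  \<open>\<aa>\<^sub>0\<close>, and so modulo \<open>P\<^sub>A\<close>; counting monomials of bounded degree in the \<open>n - |A|\<close> remaining
  variables yields \<open>r \<le> n - |A|\<close>. So depth and dimension differ.
\<close>

section \<open>Ideals of a type-class ring\<close>

lemma type_ring_simps [simp]:
  "carrier ring_of_type_algebra = UNIV"
  "x \<otimes>\<^bsub>ring_of_type_algebra\<^esub> y = x * y"
  "x \<oplus>\<^bsub>ring_of_type_algebra\<^esub> y = x + y"
  "\<zero>\<^bsub>ring_of_type_algebra\<^esub> = 0"
  "\<one>\<^bsub>ring_of_type_algebra\<^esub> = 1"
  by (simp_all add: ring_of_type_algebra_def)

lemma type_ring_a_inv [simp]:
  "\<ominus>\<^bsub>ring_of_type_algebra\<^esub> x = - (x :: 'a::comm_ring_1)"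
proof -
  interpret R: ring "ring_of_type_algebra :: 'a ring" by (rule ring_from_type_algebra)
  show ?thesis using R.minus_equality[of "-x" x] by simp
qed

lemma ideal_type_ring_iff:
  fixes J :: "'a::comm_ring_1 set"
  shows "ideal J ring_of_type_algebra \<longleftrightarrow>
    0 \<in> J \<and> (\<forall>x\<in>J. \<forall>y\<in>J. x + y \<in> J) \<and> (\<forall>x\<in>J. \<forall>a. a * x \<in> J)"
proof
  assume J: "ideal J ring_of_type_algebra"
  interpret ideal J "ring_of_type_algebra :: 'a ring" by (rule J)
  show "0 \<in> J \<and> (\<forall>x\<in>J. \<forall>y\<in>J. x + y \<in> J) \<and> (\<forall>x\<in>J. \<forall>a. a * x \<in> J)"
    using additive_subgroup.zero_closed[OF additive_subgroup_axioms]
      additive_subgroup.a_closed[OF additive_subgroup_axioms] I_l_closed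
    by simp
next
  assume J: "0 \<in> J \<and> (\<forall>x\<in>J. \<forall>y\<in>J. x + y \<in> J) \<and> (\<forall>x\<in>J. \<forall>a. a * x \<in> J)"
  have neg: "- x \<in> J" if "x \<in> J" for x
    using J that by (metis mult_minus1)
  show "ideal J ring_of_type_algebra"
  proof (rule idealI)
    show "ring (ring_of_type_algebra :: 'a ring)" by (rule ring_from_type_algebra)
    show "subgroup J (add_monoid ring_of_type_algebra)"
    proof
      fix x assume "x \<in> J"
      then show "inv\<^bsub>add_monoid ring_of_type_algebra\<^esub> x \<in> J"
        using neg type_ring_a_inv[of x] by (simp add: a_inv_def)
    qed (use J in auto)
  qed (use J in \<open>auto simp: mult.commute\<close>)
qed

lemma
  fixes J :: "'a::comm_ring_1 set"
  assumes "ideal J ring_of_type_algebra"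
  shows type_ideal_zero: "0 \<in> J"
    and type_ideal_add: "x \<in> J \<Longrightarrow> y \<in> J \<Longrightarrow> x + y \<in> J"
    and type_ideal_mult: "x \<in> J \<Longrightarrow> a * x \<in> J"
    and type_ideal_diff: "x \<in> J \<Longrightarrow> y \<in> J \<Longrightarrow> x - y \<in> J"
    and type_ideal_sum: "(\<And>i. i \<in> Y \<Longrightarrow> h i \<in> J) \<Longrightarrow> sum h Y \<in> J"
proof -
  have J: "0 \<in> J" "\<And>x y. x \<in> J \<Longrightarrow> y \<in> J \<Longrightarrow> x + y \<in> J" "\<And>x a. x \<in> J \<Longrightarrow> a * x \<in> J"
    using assms by (auto simp: ideal_type_ring_iff)
  show "0 \<in> J" "x \<in> J \<Longrightarrow> y \<in> J \<Longrightarrow> x + y \<in> J" "x \<in> J \<Longrightarrow> a * x \<in> J"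
    using J by auto
  show "x \<in> J \<Longrightarrow> y \<in> J \<Longrightarrow> x - y \<in> J"
    using J(2)[of x "-1 * y"] J(3)[of y "-1"] by simp
  show "(\<And>i. i \<in> Y \<Longrightarrow> h i \<in> J) \<Longrightarrow> sum h Y \<in> J"
    by (induction Y rule: infinite_finite_induct) (auto intro: J)
qed

lemma primeideal_type_ring_iff:
  fixes P :: "'a::comm_ring_1 set"
  shows "primeideal P ring_of_type_algebra \<longleftrightarrow>
    ideal P ring_of_type_algebra \<and> 1 \<notin> P \<and> (\<forall>x y. x * y \<in> P \<longrightarrow> x \<in> P \<or> y \<in> P)"
proof -
  have "P = UNIV" if "1 \<in> P" "ideal P ring_of_type_algebra"
    using type_ideal_mult[OF that(2,1)] by auto
  then show ?thesis
    using cring_from_type_algebra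
    by (auto simp: primeideal_def primeideal_axioms_def)
qed

lemma ideal_pow_2_eq:
  fixes J :: "'a::comm_ring_1 set"
  assumes "ideal J ring_of_type_algebra"
  shows "ideal_pow ring_of_type_algebra J 2 = ideal_prod ring_of_type_algebra J J"
proof -
  interpret R: cring "ring_of_type_algebra :: 'a ring" by (rule cring_from_type_algebra)
  \<comment> \<open>Powers start from the unit of the monoid of ideals, which is the whole ring, so
    the square unfolds to a product of three ideals whose first factor has to be absorbed.\<close>
  have "ideal_prod ring_of_type_algebra UNIV J = J"
    using R.ideal_prod_one[OF assms] R.ideal_prod_commute[OF assms R.oneideal] by simp
  then show ?thesis
    by (simp add: numeral_2_eq_2 ideals_set_def)
qed

lemma ideal_prod_mono:
  assumes "J \<subseteq> J'" "K \<subseteq> K'"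
  shows "ideal_prod R J K \<subseteq> ideal_prod R J' K'"
proof
  fix x assume "x \<in> ideal_prod R J K"
  then show "x \<in> ideal_prod R J' K'"
    by induction (use assms in \<open>auto intro: ideal_prod.intros\<close>)
qed


section \<open>Monomial ideals as support conditions\<close>

definition upclosed :: "('a::comm_monoid_add) set \<Rightarrow> bool" where
  "upclosed U \<longleftrightarrow> (\<forall>m\<in>U. \<forall>d. m + d \<in> U)"

definition upset :: "('a::comm_monoid_add) set \<Rightarrow> 'a set" where
  "upset E = {e + d | e d. e \<in> E}"

definition sumset :: "('a::comm_monoid_add) set \<Rightarrow> 'a set \<Rightarrow> 'a set" where
  "sumset U V = {a + b | a b. a \<in> U \<and> b \<in> V}"

text \<open>For \<open>upclosed U\<close> this is the monomial ideal whose monomials have exponents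
  in \<open>U\<close>. Then \<open>upset E\<close> encodes the ideal generated by \<open>E\<close>
  and \<open>sumset\<close> the product of ideals, so ideal membership becomes a condition on
  exponent vectors.\<close>

definition supp_ideal :: "('n::finite \<Rightarrow>\<^sub>0 nat) set \<Rightarrow> ('n, 'k::field) mpoly set" where
  "supp_ideal U = {p. Poly_Mapping.keys p \<subseteq> U}"

lemma upset_self: "e \<in> E \<Longrightarrow> e \<in> upset E"
  unfolding upset_def by (metis (mono_tags, lifting) add.right_neutral mem_Collect_eq)

lemma upclosed_upset: "upclosed (upset E)"
  unfolding upclosed_def upset_def by (auto simp: add.assoc) metis

lemma upclosed_sumset: "upclosed U \<Longrightarrow> upclosed (sumset U V)"
  unfolding upclosed_def sumset_def
  by (smt (verit, del_insts) add.commute add.left_commute mem_Collect_eq)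

lemma keys_monomial [simp]: "Poly_Mapping.keys (monomial m :: ('n::finite, 'k::field) mpoly) = {m}"
  by (simp add: monomial_def)

lemma monomial_mem_supp_ideal [simp]: "monomial m \<in> supp_ideal U \<longleftrightarrow> m \<in> U"
  by (simp add: supp_ideal_def)

lemma monomial_mult: "monomial a * monomial b = monomial (a + b)"
  by (simp add: monomial_def mult_single)

lemma mpoly_expansion:
  fixes p :: "('n::finite, 'k::field) mpoly"
  shows "p = (\<Sum>m\<in>Poly_Mapping.keys p. Poly_Mapping.single 0 (Poly_Mapping.lookup p m) * monomial m)"
  by (rule poly_mapping_eqI)
    (auto simp: monomial_def mult_single lookup_sum lookup_single when_def in_keys_iff)

lemma ideal_supp_ideal:
  assumes "upclosed U"
  shows "ideal (supp_ideal U :: ('n::finite, 'k::field) mpoly set) mpoly_ring"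
  unfolding ideal_type_ring_iff
proof (intro conjI ballI allI)
  show "0 \<in> supp_ideal U" by (simp add: supp_ideal_def)
next
  fix x y :: "('n, 'k) mpoly" assume "x \<in> supp_ideal U" "y \<in> supp_ideal U"
  then show "x + y \<in> supp_ideal U" using Poly_Mapping.keys_add[of x y] by (auto simp: supp_ideal_def)
next
  fix x a :: "('n, 'k) mpoly" assume x: "x \<in> supp_ideal U"
  show "a * x \<in> supp_ideal U"
    unfolding supp_ideal_def
  proof safe
    fix m assume "m \<in> Poly_Mapping.keys (a * x)"
    then obtain b c where "m = b + c" "c \<in> Poly_Mapping.keys x"
      using keys_mult[of a x] by blast
    then show "m \<in> U" using x assms by (auto simp: supp_ideal_def upclosed_def add.commute[of b])
  qed
qed

lemma supp_ideal_subset: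
  fixes J :: "('n::finite, 'k::field) mpoly set"
  assumes J: "ideal J mpoly_ring" and sub: "\<And>m. m \<in> U \<Longrightarrow> monomial m \<in> J"
  shows "supp_ideal U \<subseteq> J"
proof
  fix p :: "('n, 'k) mpoly" assume "p \<in> supp_ideal U"
  then have "(\<Sum>m\<in>Poly_Mapping.keys p. Poly_Mapping.single 0 (Poly_Mapping.lookup p m) * monomial m) \<in> J"
    by (intro type_ideal_sum[OF J] type_ideal_mult[OF J] sub) (auto simp: supp_ideal_def)
  then show "p \<in> J" using mpoly_expansion[of p] by simp
qed

lemma genideal_monomials:
  "Idl\<^bsub>mpoly_ring\<^esub> (monomial ` E) = (supp_ideal (upset E) :: ('n::finite, 'k::field) mpoly set)"
proof -
  interpret R: cring "mpoly_ring :: ('n, 'k) mpoly ring" by (rule cring_from_type_algebra)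
  let ?G = "Idl\<^bsub>mpoly_ring\<^esub> (monomial ` E) :: ('n, 'k) mpoly set"
  have G: "ideal ?G mpoly_ring" by (rule R.genideal_ideal) simp
  have mem: "monomial e \<in> ?G" if "e \<in> E" for e
    using R.genideal_self[of "monomial ` E"] that by auto
  show ?thesis
  proof
    show "?G \<subseteq> supp_ideal (upset E)"
      by (intro R.genideal_minimal ideal_supp_ideal upclosed_upset) (auto intro: upset_self)
    show "supp_ideal (upset E) \<subseteq> ?G"
    proof (rule supp_ideal_subset[OF G])
      fix m assume "m \<in> upset E"
      then obtain e d where "m = d + e" "e \<in> E" unfolding upset_def using add.commute by blast
      then show "monomial m \<in> ?G"
        using type_ideal_mult[OF G mem, of e "monomial d"] by (simp add: monomial_mult)
    qed
  qed
qed

lemma supp_ideal_pow_2: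
  assumes "upclosed U"
  shows "ideal_pow mpoly_ring (supp_ideal U) 2 =
    (supp_ideal (sumset U U) :: ('n::finite, 'k::field) mpoly set)"
proof -
  interpret R: cring "mpoly_ring :: ('n, 'k) mpoly ring" by (rule cring_from_type_algebra)
  let ?J = "supp_ideal U :: ('n, 'k) mpoly set"
  have J: "ideal ?J mpoly_ring" by (rule ideal_supp_ideal[OF assms])
  have "ideal_prod mpoly_ring ?J ?J = supp_ideal (sumset U U)"
  proof
    show "ideal_prod mpoly_ring ?J ?J \<subseteq> supp_ideal (sumset U U)"
    proof
      fix x :: "('n, 'k) mpoly"
      assume "x \<in> ideal_prod mpoly_ring ?J ?J"
      then show "x \<in> supp_ideal (sumset U U)"
      proof induction
        case (prod i j)
        then show ?case using keys_mult[of i j] unfolding supp_ideal_def sumset_def by fastforce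
      next
        case (sum x y)
        then show ?case using Poly_Mapping.keys_add[of x y] by (auto simp: supp_ideal_def)
      qed
    qed
    show "supp_ideal (sumset U U) \<subseteq> ideal_prod mpoly_ring ?J ?J"
    proof (rule supp_ideal_subset)
      show "ideal (ideal_prod mpoly_ring ?J ?J) mpoly_ring" by (rule R.ideal_prod_is_ideal[OF J J])
      fix m assume "m \<in> sumset U U"
      then obtain a b where "m = a + b" "a \<in> U" "b \<in> U" by (auto simp: sumset_def)
      then show "monomial m \<in> ideal_prod mpoly_ring ?J ?J"
        using ideal_prod.prod[of "monomial a" ?J "monomial b" ?J mpoly_ring]
        by (simp add: monomial_mult)
    qed
  qed
  then show ?thesis using ideal_pow_2_eq[OF J] by simp
qed


section \<open>Dickson's lemma and Hilbert's basis theorem\<close>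

lemma nat_seq_mono_subseq:
  fixes f :: "nat \<Rightarrow> nat"
  obtains r :: "nat \<Rightarrow> nat" where "strict_mono r" "mono (\<lambda>k. f (r k))"
proof -
  obtain r :: "nat \<Rightarrow> nat" where r: "strict_mono r" "monoseq (\<lambda>n. f (r n))"
    using seq_monosub[of f] by blast
  show ?thesis
  proof (cases "incseq (\<lambda>n. f (r n))")
    case True
    then show ?thesis by (rule that[OF r(1)])
  next
    case False
    then have dec: "decseq (\<lambda>n. f (r n))" using r(2) by (simp add: monoseq_iff)
    \<comment> \<open>A decreasing sequence of naturals is constant from an index on where its
      minimum is attained.\<close>
    obtain N where N: "\<And>n. f (r N) \<le> f (r n)"
      using ex_has_least_nat[of "\<lambda>_. True" 0 "\<lambda>n. f (r n)"] by auto
    have "f (r (N + k)) = f (r N)" for k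
      using N[of "N + k"] decseqD[OF dec, of N "N + k"] by simp
    then have "mono (\<lambda>k. f (r (N + k)))" by (intro monoI) (simp only: order_refl)
    moreover have "strict_mono (\<lambda>k. r (N + k))"
      by (intro strict_monoI strict_monoD[OF r(1)]) simp
    ultimately show ?thesis by (rule that[rotated])
  qed
qed

text \<open>Coordinates are treated one at a time: thinning out further for a new coordinate keeps
  the earlier ones monotone.\<close>

lemma dickson_subseq:
  fixes f :: "nat \<Rightarrow> 'a \<Rightarrow> nat"
  assumes "finite V"
  shows "\<exists>r :: nat \<Rightarrow> nat. strict_mono r \<and> (\<forall>v\<in>V. mono (\<lambda>k. f (r k) v))"
  using assms
proof (induction V)
  case empty
  have "strict_mono (id :: nat \<Rightarrow> nat)" by (simp add: strict_mono_def)
  then show ?case by blast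
next
  case (insert v V)
  then obtain r :: "nat \<Rightarrow> nat" where r: "strict_mono r" "\<forall>w\<in>V. mono (\<lambda>k. f (r k) w)" by blast
  obtain s :: "nat \<Rightarrow> nat" where s: "strict_mono s" "mono (\<lambda>k. f (r (s k)) v)"
    by (rule nat_seq_mono_subseq[of "\<lambda>k. f (r k) v"])
  have "mono (\<lambda>k. f (r (s k)) w)" if "w \<in> V" for w
  proof (rule monoI)
    fix i j :: nat assume "i \<le> j"
    then show "f (r (s i)) w \<le> f (r (s j)) w"
      using that r(2) monoD[of "\<lambda>k. f (r k) w"] monoD[OF strict_mono_mono[OF s(1)]] by blast
  qed
  moreover have "strict_mono (\<lambda>k. r (s k))"
    by (intro strict_monoI strict_monoD[OF r(1)] strict_monoD[OF s(1)])
  ultimately show ?case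
    using s(2) by blast
qed

text \<open>Along a subsequence that is monotone in every coordinate the first term divides the
  second, and truncated subtraction gives the cofactor.\<close>

lemma dickson:
  fixes m :: "nat \<Rightarrow> ('n::finite \<Rightarrow>\<^sub>0 nat)"
  obtains i j d where "i < j" "m j = m i + d"
proof -
  obtain r :: "nat \<Rightarrow> nat" where r: "strict_mono r"
    "\<forall>v\<in>UNIV. mono (\<lambda>k. Poly_Mapping.lookup (m (r k)) v)"
    using dickson_subseq[where V = UNIV and f = "\<lambda>k. Poly_Mapping.lookup (m k)"] finite by blast
  have "m (r 1) = m (r 0) + (m (r 1) - m (r 0))"
  proof (rule poly_mapping_eqI)
    fix v
    have "Poly_Mapping.lookup (m (r 0)) v \<le> Poly_Mapping.lookup (m (r 1)) v"
      using r(2) monoD[of "\<lambda>k. Poly_Mapping.lookup (m (r k)) v" 0 1] by simp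
    then show "Poly_Mapping.lookup (m (r 1)) v = Poly_Mapping.lookup (m (r 0) + (m (r 1) - m (r 0))) v"
      by (simp only: lookup_add lookup_minus le_add_diff_inverse)
  qed
  moreover have "r 0 < r 1" using r(1) by (rule strict_monoD) simp
  ultimately show ?thesis by (rule that[rotated])
qed

text \<open>Renumbering the variables by natural numbers transports the lexicographic order, giving a
  monomial order.\<close>

definition mord :: "('n::finite \<Rightarrow>\<^sub>0 nat) \<Rightarrow> (nat \<Rightarrow>\<^sub>0 nat)" where
  "mord = (SOME \<phi>. inj \<phi> \<and> (\<forall>a b. \<phi> (a + b) = \<phi> a + \<phi> b))"

lemma inj_mord: "inj (mord :: ('n::finite \<Rightarrow>\<^sub>0 nat) \<Rightarrow> _)"
  and mord_add: "mord (a + b) = mord (a :: 'n \<Rightarrow>\<^sub>0 nat) + mord b"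
proof -
  obtain e :: "'n \<Rightarrow> nat" where e: "inj e"
    using finite_imp_inj_to_nat_seg[of "UNIV :: 'n set"] by auto
  define \<phi> :: "('n \<Rightarrow>\<^sub>0 nat) \<Rightarrow> (nat \<Rightarrow>\<^sub>0 nat)"
    where "\<phi> m = (\<Sum>i\<in>UNIV. Poly_Mapping.single (e i) (Poly_Mapping.lookup m i))" for m
  have look: "Poly_Mapping.lookup (\<phi> m) (e i) = Poly_Mapping.lookup m i" for m i
    using e by (auto simp: \<phi>_def lookup_sum lookup_single when_def inj_eq)
  have "inj \<phi>"
  proof (rule injI)
    fix a b assume "\<phi> a = \<phi> b"
    then show "a = b" using look[of a] look[of b] by (intro poly_mapping_eqI) metis
  qed
  moreover have "\<phi> (a + b) = \<phi> a + \<phi> b" for a b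
    by (simp add: \<phi>_def lookup_add single_add sum.distrib)
  ultimately have "\<exists>\<phi> :: ('n \<Rightarrow>\<^sub>0 nat) \<Rightarrow> (nat \<Rightarrow>\<^sub>0 nat). inj \<phi> \<and> (\<forall>a b. \<phi> (a + b) = \<phi> a + \<phi> b)"
    by blast
  from someI_ex[OF this] show "inj (mord :: ('n \<Rightarrow>\<^sub>0 nat) \<Rightarrow> _)"
    "mord (a + b) = mord (a :: 'n \<Rightarrow>\<^sub>0 nat) + mord b"
    unfolding mord_def by blast+
qed

lemma lex_nonneg: "0 \<le> (x :: nat \<Rightarrow>\<^sub>0 nat)"
proof (rule ccontr)
  assume "\<not> 0 \<le> x"
  then have "x < 0" by simp
  then show False by (auto simp: less_poly_mapping.rep_eq less_fun_def)
qed

lemma mord_add_ge: "mord a \<le> mord (a + d)"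
  using add_left_mono[OF lex_nonneg[of "mord d"], of "mord a"] by (simp add: mord_add)

text \<open>In an infinite descent Dickson's lemma finds an earlier monomial dividing a later one,
  but a multiple is never smaller.\<close>

lemma wf_mord: "wf {(a, b). mord a < mord (b :: 'n::finite \<Rightarrow>\<^sub>0 nat)}"
  unfolding wf_iff_no_infinite_down_chain
proof safe
  fix m :: "nat \<Rightarrow> ('n \<Rightarrow>\<^sub>0 nat)"
  assume "\<forall>i. (m (Suc i), m i) \<in> {(a, b). mord a < mord b}"
  then have step: "mord (m (Suc i)) < mord (m i)" for i by simp
  have dec: "mord (m j) < mord (m i)" if "i < j" for i j
    using that by (induction rule: less_Suc_induct) (auto intro: step less_trans)
  obtain i j d where ij: "i < j" "m j = m i + d" by (rule dickson)
  have "mord (m i) \<le> mord (m j)" unfolding ij(2) by (rule mord_add_ge)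
  with dec[OF ij(1)] show False by simp
qed

section \<open>Leading monomials and Noetherianity\<close>

definition lm :: "('n::finite, 'k::field) mpoly \<Rightarrow> ('n \<Rightarrow>\<^sub>0 nat)" where
  "lm p = (SOME m. m \<in> Poly_Mapping.keys p \<and> (\<forall>m'\<in>Poly_Mapping.keys p. mord m' \<le> mord m))"

lemma
  fixes p :: "('n::finite, 'k::field) mpoly"
  assumes "p \<noteq> 0"
  shows lm_in_keys: "lm p \<in> Poly_Mapping.keys p"
    and lm_max: "m \<in> Poly_Mapping.keys p \<Longrightarrow> mord m \<le> mord (lm p)"
proof -
  let ?K = "mord ` Poly_Mapping.keys p"
  have ne: "finite ?K" "?K \<noteq> {}" using assms keys_eq_empty[of p] by auto
  have "Max ?K \<in> ?K" using ne by (rule Max_in)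
  then obtain m where m: "Max ?K = mord m" "m \<in> Poly_Mapping.keys p" by (rule imageE)
  have "mord m' \<le> mord m" if "m' \<in> Poly_Mapping.keys p" for m'
    using that ne(1) by (simp flip: m(1))
  then have "\<exists>m. m \<in> Poly_Mapping.keys p \<and> (\<forall>m'\<in>Poly_Mapping.keys p. mord m' \<le> mord m)"
    using m(2) by blast
  from someI_ex[OF this] show "lm p \<in> Poly_Mapping.keys p"
    "m \<in> Poly_Mapping.keys p \<Longrightarrow> mord m \<le> mord (lm p)" for m
    unfolding lm_def by blast+
qed

lemma lookup_single_mult:
  fixes p :: "('n::finite, 'k::field) mpoly"
  shows "Poly_Mapping.lookup (Poly_Mapping.single d c * p) (d + m) = c * Poly_Mapping.lookup p m"
proof -
  have "Poly_Mapping.single d c * p =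
    (\<Sum>m\<in>Poly_Mapping.keys p. Poly_Mapping.single (d + m) (c * Poly_Mapping.lookup p m))"
    by (subst mpoly_expansion[of p]) (simp add: sum_distrib_left monomial_def mult_single)
  then show ?thesis
    by (auto simp: lookup_sum lookup_single when_def in_keys_iff)
qed

text \<open>Every other pair of monomials of \<open>p\<close> and \<open>q\<close> has a strictly
  smaller sum under \<open>mord\<close>, so nothing can interfere with the product of the leading
  terms.\<close>

lemma lookup_mult_lm:
  fixes p q :: "('n::finite, 'k::field) mpoly"
  assumes "p \<noteq> 0" "q \<noteq> 0"
  shows "Poly_Mapping.lookup (p * q) (lm p + lm q) =
    Poly_Mapping.lookup p (lm p) * Poly_Mapping.lookup q (lm q)"
proof -
  let ?t = "lm p + lm q"
  let ?c = "Poly_Mapping.lookup p"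
  have zero: "Poly_Mapping.lookup (Poly_Mapping.single m (?c m) * q) ?t = 0"
    if m: "m \<in> Poly_Mapping.keys p" "m \<noteq> lm p" for m
  proof (rule ccontr)
    assume "Poly_Mapping.lookup (Poly_Mapping.single m (?c m) * q) ?t \<noteq> 0"
    then have "?t \<in> Poly_Mapping.keys (Poly_Mapping.single m (?c m) * q)"
      by (simp add: in_keys_iff)
    then obtain m' where m': "m' \<in> Poly_Mapping.keys q" "?t = m + m'"
      using keys_mult[of "Poly_Mapping.single m (?c m)" q] by (auto split: if_splits)
    have "mord m < mord (lm p)"
      using lm_max[OF assms(1) m(1)] m(2) inj_mord by (metis inj_eq order_le_less)
    then have "mord (m + m') < mord ?t"
      using lm_max[OF assms(2) m'(1)] by (simp add: mord_add add_less_le_mono)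
    then show False using m'(2) by simp
  qed
  have "p * q = (\<Sum>m\<in>Poly_Mapping.keys p. Poly_Mapping.single m (?c m) * q)"
    by (subst mpoly_expansion[of p]) (simp add: sum_distrib_right monomial_def mult_single)
  then have "Poly_Mapping.lookup (p * q) ?t =
    (\<Sum>m\<in>Poly_Mapping.keys p. Poly_Mapping.lookup (Poly_Mapping.single m (?c m) * q) ?t)"
    by (simp add: lookup_sum)
  also have "\<dots> = Poly_Mapping.lookup (Poly_Mapping.single (lm p) (?c (lm p)) * q) ?t"
    using lm_in_keys[OF assms(1)] zero
    by (subst sum.remove[of _ "lm p"]) (auto intro!: sum.neutral)
  finally show ?thesis by (simp add: lookup_single_mult)
qed

lemma mpoly_mult_nonzero:
  fixes p q :: "('n::finite, 'k::field) mpoly"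
  assumes "p \<noteq> 0" "q \<noteq> 0"
  shows "p * q \<noteq> 0"
  using lookup_mult_lm[OF assms] lm_in_keys[OF assms(1)] lm_in_keys[OF assms(2)]
  by (auto simp: in_keys_iff)

text \<open>Subtracting from \<open>g\<^sub>k\<close> a combination of its predecessors that minimizes the leading monomial,
  Dickson's lemma would allow one more reduction step.\<close>

lemma mpoly_noetherian:
  fixes g :: "nat \<Rightarrow> ('n::finite, 'k::field) mpoly"
  shows "\<exists>k b. g k = (\<Sum>i<k. b i * g i)"
proof (rule ccontr)
  assume "\<not> ?thesis"
  then have neq: "g k - (\<Sum>i<k. b i * g i) \<noteq> 0" for k b by auto
  \<comment> \<open>\<open>H k\<close> is the coset of \<open>g k\<close> modulo the ideal generated
    by its predecessors; the assumption says that 0 lies in none of these cosets.\<close>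
  define H where "H k = {g k - (\<Sum>i<k. b i * g i) | b. True}" for k
  have "\<exists>p\<in>H k. \<forall>q\<in>H k. \<not> mord (lm q) < mord (lm p)" for k
  proof -
    have "g k - (\<Sum>i<k. 0 * g i) \<in> H k"
      unfolding H_def by (intro CollectI exI[of _ "\<lambda>_. 0"]) simp
    then have ne: "lm (g k - (\<Sum>i<k. 0 * g i)) \<in> lm ` H k" by blast
    obtain m where "m \<in> lm ` H k" "\<And>m'. (m', m) \<in> {(a, b). mord a < mord b} \<Longrightarrow> m' \<notin> lm ` H k"
      using wfE_min[OF wf_mord ne] by blast
    then show ?thesis by auto
  qed
  then obtain h where h: "\<And>k. h k \<in> H k" and min: "\<And>k q. q \<in> H k \<Longrightarrow> \<not> mord (lm q) < mord (lm (h k))"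
    by metis
  have "\<forall>k. \<exists>b. h k = g k - (\<Sum>i<k. b i * g i)" using h by (auto simp: H_def)
  then obtain b where b: "\<And>k. h k = g k - (\<Sum>i<k. b k i * g i)" by metis
  have h0: "h k \<noteq> 0" for k using neq b by metis
  obtain i k d where ik: "i < k" "lm (h k) = lm (h i) + d"
    by (rule dickson[of "\<lambda>k. lm (h k)"])
  let ?l = "\<lambda>p. Poly_Mapping.lookup p (lm p)"
  \<comment> \<open>\<open>t\<close> makes the leading terms of \<open>h k\<close> and
    \<open>t * h i\<close> cancel; it exists because \<open>lm (h i)\<close> divides
    \<open>lm (h k)\<close>.\<close>
  define t where "t = Poly_Mapping.single d (?l (h k) / ?l (h i))"
  define q where "q = h k - t * h i"
  have l0: "?l (h i) \<noteq> 0" using lm_in_keys[OF h0] by (simp add: in_keys_iff)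
  have "q \<in> H k"
  proof -
    \<comment> \<open>Over the \<open>g j\<close>, the coefficients of \<open>h i\<close> are 1 at
      \<open>j = i\<close> and \<open>- b i j\<close> below. Since \<open>i < k\<close>, subtracting
      \<open>t * h i\<close> does not leave the coset \<open>H k\<close>.\<close>
    let ?b = "\<lambda>j. b k j + t * (if j = i then 1 else if j < i then - b i j else 0)"
    have "(\<Sum>j<k. (if j = i then 1 else if j < i then - b i j else 0) * g j) = h i"
    proof -
      have "(\<Sum>j<k. (if j = i then 1 else if j < i then - b i j else 0) * g j) =
          (\<Sum>j<k. (if j = i then g j else 0) - (if j \<in> {..<i} then b i j * g j else 0))"
        by (rule sum.cong) auto
      also have "\<dots> = g i - (\<Sum>j\<in>{..<k} \<inter> {..<i}. b i j * g j)"
        using ik(1) by (simp add: sum_subtractf sum.inter_restrict[of "{..<k}" _ "{..<i}"])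
      also have "{..<k} \<inter> {..<i} = {..<i}" using ik(1) by auto
      finally show ?thesis by (simp add: b)
    qed
    then have "(\<Sum>j<k. ?b j * g j) = (\<Sum>j<k. b k j * g j) + t * h i"
      by (simp add: distrib_right sum.distrib mult.assoc sum_distrib_left[symmetric])
    then have "q = g k - (\<Sum>j<k. ?b j * g j)" by (simp add: q_def b[of k])
    then show ?thesis unfolding H_def by (intro CollectI exI[of _ ?b]) simp
  qed
  then have q0: "q \<noteq> 0" using neq by (auto simp: H_def)
  have "mord m \<le> mord (lm (h k))" if "m \<in> Poly_Mapping.keys q" for m
  proof -
    from that have "m \<in> Poly_Mapping.keys (h k) \<or> m \<in> Poly_Mapping.keys (t * h i)"
      using keys_diff[of "h k" "t * h i"] unfolding q_def by blast
    then show ?thesis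
    proof
      assume "m \<in> Poly_Mapping.keys (t * h i)"
      then obtain m' where "m' \<in> Poly_Mapping.keys (h i)" "m = m' + d"
        using keys_mult[of t "h i"] by (auto simp: t_def add.commute split: if_splits)
      then show ?thesis
        using lm_max[OF h0] ik(2) by (simp add: mord_add add_right_mono)
    qed (rule lm_max[OF h0])
  qed
  then have "mord (lm q) \<le> mord (lm (h k))" using lm_in_keys[OF q0] by blast
  moreover have "lm q \<noteq> lm (h k)"
  proof -
    have "Poly_Mapping.lookup q (lm (h k)) = 0"
      using l0 lookup_single_mult[of d _ "h i" "lm (h i)"]
      by (simp add: q_def lookup_minus t_def ik(2) add.commute)
    then show ?thesis using lm_in_keys[OF q0] by (auto simp: in_keys_iff)
  qed
  ultimately have "mord (lm q) < mord (lm (h k))"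
    using inj_mord by (metis inj_eq order_le_less)
  then show False using min[OF \<open>q \<in> H k\<close>] by blast
qed


section \<open>Regular sequences and algebraic independence\<close>

text \<open>Linear independence over the field of the residues modulo \<open>J\<close>, with scalars
  embedded as constant polynomials. For the family of power products of a list it expresses
  algebraic independence.\<close>

definition indep_mod :: "('n::finite, 'k::field) mpoly set \<Rightarrow> 'a set \<Rightarrow> ('a \<Rightarrow> ('n, 'k) mpoly) \<Rightarrow> bool" where
  "indep_mod J Y \<tau> \<longleftrightarrow>
     (\<forall>c. (\<Sum>x\<in>Y. Poly_Mapping.single 0 (c x) * \<tau> x) \<in> J \<longrightarrow> (\<forall>x\<in>Y. c x = 0))"

text \<open>The maximal ideal at the origin. Polynomials outside it play the role of units of the
  local ring there, so that no localization has to be formed.\<close>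

definition zero_const :: "('n::finite, 'k::field) mpoly set" where
  "zero_const = {p. Poly_Mapping.lookup p 0 = 0}"

text \<open>Two exponent vectors add up to 0 only if both are 0, so only the constant terms
  meet.\<close>

lemma lookup_mult_0:
  "Poly_Mapping.lookup (p * q) 0 =
    Poly_Mapping.lookup p 0 * Poly_Mapping.lookup (q :: ('n::finite, 'k::field) mpoly) 0"
proof -
  have zero: "Poly_Mapping.lookup (Poly_Mapping.single m c * q) 0 = 0" if "m \<noteq> 0" for m and c :: 'k
  proof (rule ccontr)
    assume "Poly_Mapping.lookup (Poly_Mapping.single m c * q) 0 \<noteq> 0"
    then have "0 \<in> Poly_Mapping.keys (Poly_Mapping.single m c * q)" by (simp add: in_keys_iff)
    then obtain m' where "0 = m + m'"
      using keys_mult[of "Poly_Mapping.single m c" q] by (auto split: if_splits)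
    then have "\<And>i. Poly_Mapping.lookup m i + Poly_Mapping.lookup m' i = 0"
      by (metis lookup_add lookup_zero)
    then have "m = 0" by (intro poly_mapping_eqI) simp
    with that show False by simp
  qed
  let ?c = "Poly_Mapping.lookup p"
  have "p * q = (\<Sum>m\<in>insert 0 (Poly_Mapping.keys p). Poly_Mapping.single m (?c m) * q)"
    by (subst mpoly_expansion[of p])
      (auto simp: sum_distrib_right monomial_def mult_single in_keys_iff intro!: sum.mono_neutral_left)
  then have "Poly_Mapping.lookup (p * q) 0 =
    (\<Sum>m\<in>insert 0 (Poly_Mapping.keys p). Poly_Mapping.lookup (Poly_Mapping.single m (?c m) * q) 0)"
    by (simp add: lookup_sum)
  also have "\<dots> = Poly_Mapping.lookup (Poly_Mapping.single 0 (?c 0) * q) 0"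
    using zero by (subst sum.remove[of _ 0]) (auto intro!: sum.neutral)
  finally show ?thesis using lookup_single_mult[of 0 "?c 0" q 0] by simp
qed

text \<open>This is Krull's intersection theorem at the origin in disguise: the vectors \<open>v\<close> are obtained
  by dividing \<open>u\<close> by \<open>f\<close> as often as possible, locally at the origin and modulo \<open>L\<close>.\<close>

lemma annihilator_step:
  fixes L L' I :: "('n::finite, 'k::field) mpoly set"
  assumes L: "ideal L mpoly_ring" and I: "ideal I mpoly_ring"
    and f: "f \<in> zero_const"
    and nzd: "\<And>v. v \<in> I \<Longrightarrow> f * v \<in> L \<Longrightarrow> v \<in> L"
    and lift: "\<And>v. v \<in> L' \<Longrightarrow> \<exists>w\<in>I. v - f * w \<in> L"
    and u: "u \<in> I" "\<And>g. g * u \<in> L \<Longrightarrow> g \<in> zero_const"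
  shows "\<exists>v\<in>I. (\<forall>g. g * u \<in> L \<longrightarrow> g * v \<in> L) \<and> (\<forall>g. g * v \<in> L' \<longrightarrow> g \<in> zero_const)"
proof (rule ccontr)
  assume no: "\<not> ?thesis"
  \<comment> \<open>\<open>?V\<close> collects the elements of \<open>I\<close> killed modulo
    \<open>L\<close> by everything that kills \<open>u\<close>. By assumption each of them is
    multiplied into \<open>L'\<close> by some \<open>s\<close> outside \<open>zero_const\<close>,
    and \<open>lift\<close> then divides the product by \<open>f\<close> modulo
    \<open>L\<close>.\<close>
  let ?V = "{v \<in> I. \<forall>g. g * u \<in> L \<longrightarrow> g * v \<in> L}"
  have step: "\<exists>w s. w \<in> ?V \<and> s \<notin> zero_const \<and> s * v - f * w \<in> L" if v: "v \<in> ?V" for v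
  proof -
    obtain s where s: "s * v \<in> L'" "s \<notin> zero_const" using no v by blast
    obtain w where w: "w \<in> I" "s * v - f * w \<in> L" using lift[OF s(1)] by blast
    \<comment> \<open>The quotient \<open>w\<close> stays in \<open>?V\<close>: modulo
      \<open>L\<close>, \<open>f * (g * w)\<close> agrees with \<open>s * (g * v)\<close>, which
      lies in \<open>L\<close>, and \<open>f\<close> can be cancelled.\<close>
    have "g * w \<in> L" if "g * u \<in> L" for g
    proof (rule nzd)
      show "g * w \<in> I" by (rule type_ideal_mult[OF I w(1)])
      have "s * (g * v) - g * (s * v - f * w) \<in> L"
        using type_ideal_diff[OF L type_ideal_mult[OF L, of "g * v" s] type_ideal_mult[OF L w(2), of g]]
          v that by blast
      then show "f * (g * w) \<in> L" by (simp add: algebra_simps)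
    qed
    then show ?thesis using w s(2) by blast
  qed
  define W where "W v = (SOME w. \<exists>s. w \<in> ?V \<and> s \<notin> zero_const \<and> s * v - f * w \<in> L)" for v
  define S where "S v = (SOME s. W v \<in> ?V \<and> s \<notin> zero_const \<and> s * v - f * W v \<in> L)" for v
  have WS: "W v \<in> ?V \<and> S v \<notin> zero_const \<and> S v * v - f * W v \<in> L" if "v \<in> ?V" for v
    unfolding S_def by (rule someI_ex, unfold W_def, rule someI_ex, rule step[OF that])
  define v where "v i = (W ^^ i) u" for i
  define s where "s i = S (v i)" for i
  have V: "v i \<in> ?V" for i
    by (induction i) (use u(1) WS in \<open>auto simp: v_def\<close>)
  have s: "s i \<notin> zero_const" "s i * v i - f * v (Suc i) \<in> L" for i
    using WS[OF V[of i]] by (simp_all add: s_def v_def)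
  let ?s = "\<lambda>k. \<Prod>i<k. s i"
  have pow: "?s k * u - f ^ k * v k \<in> L" for k
  proof (induction k)
    case 0
    then show ?case using type_ideal_zero[OF L] by (simp add: v_def)
  next
    case (Suc k)
    have "s k * (?s k * u - f ^ k * v k) + f ^ k * (s k * v k - f * v (Suc k)) \<in> L"
      by (intro type_ideal_add[OF L] type_ideal_mult[OF L] Suc s(2))
    then show ?case by (simp add: algebra_simps)
  qed
  have s_prod: "Poly_Mapping.lookup (?s k) 0 \<noteq> 0" for k
    by (induction k) (use s(1) in \<open>auto simp: lookup_mult_0 zero_const_def\<close>)
  \<comment> \<open>The ideals generated by initial segments of the sequence \<open>v\<close> cannot
    grow forever.\<close>
  obtain k b where k: "v k = (\<Sum>i<k. b i * v i)" using mpoly_noetherian[of v] by blast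
  \<comment> \<open>Multiply the relation \<open>pow\<close> for each \<open>i < k\<close> by
    \<open>b i * f ^ (k - i)\<close> and add up. The terms in \<open>u\<close> all keep a factor
    \<open>f\<close> because \<open>k - i\<close> is positive, and the other terms combine to
    \<open>f ^ k * v k\<close>.\<close>
  let ?h = "\<Sum>i<k. b i * f ^ (k - Suc i) * ?s i"
  have "(\<Sum>i<k. (b i * f ^ (k - i)) * (?s i * u - f ^ i * v i)) \<in> L"
    by (intro type_ideal_sum[OF L] type_ideal_mult[OF L] pow)
  also have "(\<Sum>i<k. (b i * f ^ (k - i)) * (?s i * u - f ^ i * v i)) = f * ?h * u - f ^ k * v k"
  proof -
    have "(b i * f ^ (k - i)) * (?s i * u - f ^ i * v i) =
        f * (b i * f ^ (k - Suc i) * ?s i) * u - f ^ k * (b i * v i)" if "i < k" for i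
    proof -
      have "f ^ (k - i) = f * f ^ (k - Suc i)" using that by (metis Suc_diff_Suc power_Suc)
      moreover have "f ^ k = f ^ (k - i) * f ^ i" using that by (simp flip: power_add)
      ultimately show ?thesis by (simp add: algebra_simps)
    qed
    then show ?thesis
      by (simp add: k sum_subtractf sum_distrib_left sum_distrib_right)
  qed
  finally have "(?s k * u - f ^ k * v k) - (f * ?h * u - f ^ k * v k) \<in> L"
    by (rule type_ideal_diff[OF L pow])
  then have "(?s k - f * ?h) * u \<in> L" by (simp add: algebra_simps)
  \<comment> \<open>The difference kills \<open>u\<close> modulo \<open>L\<close> and so vanishes at
    the origin, where \<open>f * ?h\<close> is zero but the product of the \<open>s i\<close> is
    not.\<close>
  from u(2)[OF this] have "Poly_Mapping.lookup (?s k) 0 = Poly_Mapping.lookup f 0 * Poly_Mapping.lookup ?h 0"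
    by (simp add: zero_const_def lookup_minus lookup_mult_0)
  then show False using f s_prod[of k] by (simp add: zero_const_def)
qed

text \<open>Each entry is bounded separately instead of the total degree, so the number of these
  lists is exactly \<open>(t + 1) ^ r\<close>.\<close>

abbreviation exponents :: "nat \<Rightarrow> nat \<Rightarrow> nat list set" where
  "exponents r t \<equiv> {l. set l \<subseteq> {..t} \<and> length l = r}"

definition power_prod :: "'a::comm_ring_1 list \<Rightarrow> nat list \<Rightarrow> 'a" where
  "power_prod fs l = prod_list (map2 (^) fs l)"

lemma power_prod_Cons [simp]: "power_prod (f # fs) (i # l) = f ^ i * power_prod fs l"
  by (simp add: power_prod_def)

text \<open>Induction on the sequence, with \<open>annihilator_step\<close> trading \<open>u\<close>
  modulo \<open>L 0\<close> for some \<open>v\<close> modulo \<open>L 1\<close>. A relation is read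
  as a polynomial in the first element \<open>f\<close>. Its lowest power of \<open>f\<close>
  cancels; applied to \<open>v\<close> modulo \<open>L 1\<close>, the remaining multiples of
  \<open>f\<close> vanish, so the lowest coefficient is a relation for the rest of the
  sequence.\<close>

lemma regular_sequence_independent:
  fixes L :: "nat \<Rightarrow> ('n::finite, 'k::field) mpoly set"
  assumes "\<And>i. i \<le> length fs \<Longrightarrow> ideal (L i) mpoly_ring" "ideal I mpoly_ring" "set fs \<subseteq> zero_const"
    and "\<And>i v. i < length fs \<Longrightarrow> v \<in> I \<Longrightarrow> fs ! i * v \<in> L i \<Longrightarrow> v \<in> L i"
    and "\<And>i v. i < length fs \<Longrightarrow> v \<in> L (Suc i) \<Longrightarrow> \<exists>w\<in>I. v - fs ! i * w \<in> L i"
    and "\<And>i v. i < length fs \<Longrightarrow> v \<in> I \<Longrightarrow> fs ! i * v \<in> L (Suc i)"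
    and "\<And>i. i < length fs \<Longrightarrow> L i \<subseteq> L (Suc i)"
    and "u \<in> I" "\<And>g. g * u \<in> L 0 \<Longrightarrow> g \<in> zero_const"
  shows "indep_mod {g. g * u \<in> L 0} (exponents (length fs) t) (power_prod fs)"
  using assms
proof (induction fs arbitrary: L u)
  case Nil
  have "exponents 0 t = {[]}" by auto
  moreover have "c = 0" if "Poly_Mapping.single 0 c * u \<in> L 0" for c
    using Nil.prems(9)[OF that] by (simp add: zero_const_def)
  ultimately show ?case by (simp add: indep_mod_def power_prod_def)
next
  case (Cons f fs)
  have L0: "ideal (L 0) mpoly_ring" and L1: "ideal (L 1) mpoly_ring"
    using Cons.prems(1)[of 0] Cons.prems(1)[of 1] by simp_all
  note I = Cons.prems(2)
  have nzd: "v \<in> L 0" if "v \<in> I" "f * v \<in> L 0" for v using Cons.prems(4)[of 0 v] that by simp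
  have fI: "f * v \<in> L 1" if "v \<in> I" for v using Cons.prems(6)[of 0 v] that by simp
  have L01: "L 0 \<subseteq> L 1" using Cons.prems(7)[of 0] by simp
  have "\<exists>v\<in>I. (\<forall>g. g * u \<in> L 0 \<longrightarrow> g * v \<in> L 0) \<and> (\<forall>g. g * v \<in> L 1 \<longrightarrow> g \<in> zero_const)"
  proof (rule annihilator_step[OF L0 I _ nzd])
    show "f \<in> zero_const" using Cons.prems(3) by simp
    show "\<exists>w\<in>I. v - f * w \<in> L 0" if "v \<in> L 1" for v using Cons.prems(5)[of 0 v] that by simp
  qed (use Cons.prems(8,9) in auto)
  then obtain v where v: "v \<in> I" "\<And>g. g * u \<in> L 0 \<Longrightarrow> g * v \<in> L 0"
    "\<And>g. g * v \<in> L 1 \<Longrightarrow> g \<in> zero_const" by blast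
  let ?r = "length fs"
  have IH: "indep_mod {g. g * v \<in> L 1} (exponents ?r t) (power_prod fs)"
  proof -
    have "indep_mod {g. g * v \<in> L (Suc 0)} (exponents ?r t) (power_prod fs)"
    proof (rule Cons.IH[of "\<lambda>i. L (Suc i)", OF _ I])
      show "ideal (L (Suc i)) mpoly_ring" if "i \<le> length fs" for i
        using Cons.prems(1)[of "Suc i"] that by simp
      show "w \<in> L (Suc i)" if "i < length fs" "w \<in> I" "fs ! i * w \<in> L (Suc i)" for i w
        using Cons.prems(4)[of "Suc i" w] that by simp
      show "\<exists>w\<in>I. z - fs ! i * w \<in> L (Suc i)" if "i < length fs" "z \<in> L (Suc (Suc i))" for i z
        using Cons.prems(5)[of "Suc i" z] that by simp
      show "fs ! i * w \<in> L (Suc (Suc i))" if "i < length fs" "w \<in> I" for i w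
        using Cons.prems(6)[of "Suc i" w] that by simp
      show "L (Suc i) \<subseteq> L (Suc (Suc i))" if "i < length fs" for i
        using Cons.prems(7)[of "Suc i"] that by simp
    qed (use Cons.prems(3) v in auto)
    then show ?thesis by simp
  qed
  have exps: "exponents (length (f # fs)) t = (\<lambda>(i, l). i # l) ` ({..t} \<times> exponents ?r t)"
  proof (rule Set.set_eqI)
    show "l \<in> exponents (length (f # fs)) t \<longleftrightarrow> l \<in> (\<lambda>(i, l). i # l) ` ({..t} \<times> exponents ?r t)" for l
      by (cases l) (auto simp: image_iff)
  qed
  have inj: "inj_on (\<lambda>(i, l). i # l) ({..t} \<times> exponents ?r t)" by (auto intro: inj_onI)
  show ?case
    unfolding indep_mod_def
  proof (rule allI, rule impI)
    fix c assume c: "(\<Sum>x\<in>exponents (length (f # fs)) t. Poly_Mapping.single 0 (c x) * power_prod (f # fs) x)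
      \<in> {g. g * u \<in> L 0}"
    \<comment> \<open>\<open>q i\<close> is the coefficient of \<open>f ^ i\<close>, a combination
      of power products of the remaining elements.\<close>
    define q where "q i = (\<Sum>l\<in>exponents ?r t. Poly_Mapping.single 0 (c (i # l)) * power_prod fs l)" for i
    have sum: "(\<Sum>i\<le>t. f ^ i * q i) * u \<in> L 0"
      using c unfolding exps sum.reindex[OF inj]
      by (simp add: sum.cartesian_product q_def sum_distrib_left case_prod_unfold mult_ac)
    have "\<forall>l\<in>exponents ?r t. c (i # l) = 0" if "i \<le> t" for i
      using that
    proof (induction i rule: less_induct)
      case (less i)
      have "q j = 0" if "j < i" for j
      proof -
        have "\<forall>l\<in>exponents ?r t. c (j # l) = 0" using less that by simp
        then show ?thesis unfolding q_def by (intro sum.neutral) auto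
      qed
      then have "(\<Sum>j\<le>t. f ^ j * q j) = (\<Sum>j\<in>{i..t}. f ^ j * q j)"
        by (intro sum.mono_neutral_right) auto
      also have "\<dots> = (\<Sum>j\<in>{i..t}. f ^ i * (f ^ (j - i) * q j))"
        by (intro sum.cong) (auto simp flip: mult.assoc power_add)
      also have "\<dots> = f ^ i * (q i + f * (\<Sum>j\<in>{Suc i..t}. f ^ (j - Suc i) * q j))"
      proof -
        have "{i..t} = insert i {Suc i..t}" using less.prems by auto
        moreover have "f ^ (j - i) = f * f ^ (j - Suc i)" if "j \<in> {Suc i..t}" for j
          using that by (metis Suc_diff_le Suc_le_lessD atLeastAtMost_iff diff_Suc_Suc power_Suc Suc_le_eq)
        ultimately show ?thesis
          by (simp add: sum_distrib_left mult.assoc distrib_left)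
      qed
      finally have eq: "f ^ i * ((q i + f * (\<Sum>j\<in>{Suc i..t}. f ^ (j - Suc i) * q j)) * u) \<in> L 0"
        using sum by (simp add: mult.assoc)
      define R where "R = (\<Sum>j\<in>{Suc i..t}. f ^ (j - Suc i) * q j)"
      have cancel: "w \<in> L 0" if "w \<in> I" "f ^ n * w \<in> L 0" for n w
        using that
      proof (induction n)
        case (Suc n)
        then show ?case
          using nzd[of "f ^ n * w"] type_ideal_mult[OF I] by (simp add: mult.assoc)
      qed simp
      have "(q i + f * R) * u \<in> L 0"
        using eq cancel type_ideal_mult[OF I Cons.prems(8)] by (simp add: R_def)
      \<comment> \<open>Passing from \<open>u\<close> to \<open>v\<close> and from
        \<open>L 0\<close> to the larger \<open>L 1\<close> is what makes the tail
        \<open>f * R\<close> disappear.\<close>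
      then have "(q i + f * R) * v \<in> L 1" using v(2) L01 by blast
      moreover have "f * (R * v) \<in> L 1" by (intro fI type_ideal_mult[OF I] v(1))
      ultimately have "(q i + f * R) * v - f * (R * v) \<in> L 1"
        by (rule type_ideal_diff[OF L1])
      then have "q i \<in> {g. g * v \<in> L 1}" by (simp add: algebra_simps)
      then show ?case
        using IH[unfolded indep_mod_def, THEN spec, of "\<lambda>l. c (i # l)"] unfolding q_def by (rule mp[rotated])
    qed
    then show "\<forall>x\<in>exponents (length (f # fs)) t. c x = 0"
      unfolding exps by force
  qed
qed


section \<open>Counting monomials\<close>

text \<open>Gaussian elimination, by induction on the set \<open>Z\<close> of equations: an equation
  that is not identically zero is solved for one unknown, leaving one equation and one unknown
  fewer.\<close>

lemma homogeneous_system_nontrivial_solution: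
  fixes a :: "'x \<Rightarrow> 'y \<Rightarrow> 'k::field"
  assumes "finite Z" "finite Y" "card Z < card Y"
  shows "\<exists>c. (\<exists>x\<in>Y. c x \<noteq> 0) \<and> (\<forall>z\<in>Z. (\<Sum>x\<in>Y. c x * a x z) = 0)"
  using assms
proof (induction Z arbitrary: Y a rule: finite_induct)
  case empty
  then show ?case by (intro exI[of _ "\<lambda>_. 1"]) (auto simp: card_gt_0_iff)
next
  case (insert y Z)
  show ?case
  proof (cases "\<forall>x\<in>Y. a x y = 0")
    case True
    have "card Z < card Y" using insert by simp
    from insert.IH[OF insert.prems(1) this, of a] True show ?thesis by auto
  next
    case False
    then obtain x0 where x0: "x0 \<in> Y" "a x0 y \<noteq> 0" by blast
    let ?Y = "Y - {x0}"
    \<comment> \<open>The system left after solving equation \<open>y\<close> for \<open>x0\<close>;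
      its coefficients at \<open>y\<close> are all zero.\<close>
    let ?a = "\<lambda>x z. a x z - a x y / a x0 y * a x0 z"
    have "finite ?Y" "card Z < card ?Y" using insert x0(1) by simp_all
    from insert.IH[OF this, of ?a] obtain c
      where c: "\<exists>x\<in>?Y. c x \<noteq> 0" "\<And>z. z \<in> Z \<Longrightarrow> (\<Sum>x\<in>?Y. c x * ?a x z) = 0" by blast
    let ?s = "\<Sum>x\<in>?Y. c x * a x y"
    \<comment> \<open>The value at \<open>x0\<close> is the one forced by equation
      \<open>y\<close>.\<close>
    let ?c = "c(x0 := - ?s / a x0 y)"
    have sum: "(\<Sum>x\<in>Y. ?c x * a x z) = (\<Sum>x\<in>?Y. c x * ?a x z)" for z
    proof -
      have "(\<Sum>x\<in>Y. ?c x * a x z) = - ?s / a x0 y * a x0 z + (\<Sum>x\<in>?Y. ?c x * a x z)"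
        using insert.prems(1) x0(1) by (subst sum.remove[of Y x0]) simp_all
      also have "(\<Sum>x\<in>?Y. ?c x * a x z) = (\<Sum>x\<in>?Y. c x * a x z)" by (rule sum.cong) auto
      finally show ?thesis
        by (simp add: right_diff_distrib sum_subtractf sum_distrib_right sum_divide_distrib sum_negf
            mult.assoc)
    qed
    have "(\<Sum>x\<in>Y. ?c x * a x z) = 0" if "z \<in> insert y Z" for z
      using that c(2) x0(2) unfolding sum by auto
    moreover have "\<exists>x\<in>Y. ?c x \<noteq> 0" using c(1) by auto
    ultimately show ?thesis by blast
  qed
qed

definition exponents_le :: "nat \<Rightarrow> ('n::finite, 'k::field) mpoly \<Rightarrow> bool" where
  "exponents_le D p \<longleftrightarrow> (\<forall>m\<in>Poly_Mapping.keys p. \<forall>i. Poly_Mapping.lookup m i \<le> D)"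

lemma exponents_le_mult:
  assumes "exponents_le D p" "exponents_le D' q"
  shows "exponents_le (D + D') (p * q)"
  unfolding exponents_le_def
proof (intro ballI allI)
  fix m i assume "m \<in> Poly_Mapping.keys (p * q)"
  then obtain a b where "m = a + b" "a \<in> Poly_Mapping.keys p" "b \<in> Poly_Mapping.keys q"
    using keys_mult[of p q] by blast
  then show "Poly_Mapping.lookup m i \<le> D + D'"
    using assms by (simp add: exponents_le_def lookup_add add_mono)
qed

lemma exponents_le_one: "exponents_le D 1"
  by (simp add: exponents_le_def)

lemma exponents_le_power:
  assumes "exponents_le D p" "i \<le> t"
  shows "exponents_le (D * t) (p ^ i)"
proof -
  have "exponents_le (D * i) (p ^ i)"
    by (induction i) (auto simp: exponents_le_one intro: exponents_le_mult assms(1))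
  then show ?thesis
    using assms(2) by (meson exponents_le_def le_trans mult_le_mono2)
qed

lemma exponents_le_power_prod:
  assumes "\<And>f. f \<in> set fs \<Longrightarrow> exponents_le D f" "l \<in> exponents (length fs) t"
  shows "exponents_le (D * t * length fs) (power_prod fs l)"
  using assms
proof (induction fs arbitrary: l)
  case Nil
  then show ?case by (simp add: power_prod_def exponents_le_one)
next
  case (Cons f fs)
  obtain i l' where l_eq: "l = i # l'" using Cons.prems(2) by (cases l) auto
  with Cons.prems(2) have l: "l = i # l'" "i \<le> t" "l' \<in> exponents (length fs) t" by auto
  have "exponents_le (D * t) (f ^ i)" by (intro exponents_le_power Cons.prems(1) l(2)) simp
  moreover have "exponents_le (D * t * length fs) (power_prod fs l')"
    by (rule Cons.IH[OF Cons.prems(1) l(3)]) simp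
  ultimately show ?case
    using exponents_le_mult[of "D * t" "f ^ i" "D * t * length fs"] by (simp add: l(1))
qed

lemma ex_exponents_le:
  fixes F :: "('n::finite, 'k::field) mpoly set"
  assumes "finite F"
  shows "\<exists>D. \<forall>f\<in>F. exponents_le D f"
proof -
  have "finite (\<Union>f\<in>F. \<Union>m\<in>Poly_Mapping.keys f. range (Poly_Mapping.lookup m))"
    using assms by simp
  then obtain D where "\<forall>x\<in>(\<Union>f\<in>F. \<Union>m\<in>Poly_Mapping.keys f. range (Poly_Mapping.lookup m)). x \<le> D"
    unfolding finite_nat_set_iff_bounded_le by blast
  then have "\<forall>f\<in>F. exponents_le D f" by (auto simp: exponents_le_def)
  then show ?thesis by blast
qed

lemma card_bounded_monomials:
  fixes A :: "'n::finite set" and D :: nat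
  defines "Z \<equiv> {m :: 'n \<Rightarrow>\<^sub>0 nat. (\<forall>i\<in>A. Poly_Mapping.lookup m i = 0) \<and> (\<forall>i. Poly_Mapping.lookup m i \<le> D)}"
  shows "finite Z" "card Z \<le> (D + 1) ^ card (- A)"
proof -
  let ?P = "PiE (- A) (\<lambda>_. {..D})"
  let ?r = "\<lambda>m :: 'n \<Rightarrow>\<^sub>0 nat. restrict (Poly_Mapping.lookup m) (- A)"
  have inj: "inj_on ?r Z"
  proof (rule inj_onI, rule poly_mapping_eqI)
    fix a b i assume ab: "a \<in> Z" "b \<in> Z" "?r a = ?r b"
    show "Poly_Mapping.lookup a i = Poly_Mapping.lookup b i"
      using ab(1,2) fun_cong[OF ab(3), of i] by (cases "i \<in> A") (auto simp: Z_def)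
  qed
  have sub: "?r ` Z \<subseteq> ?P" by (auto simp: Z_def)
  have fin: "finite ?P" by (intro finite_PiE) auto
  show "finite Z" using inj_on_finite[OF inj sub fin] .
  have "card Z \<le> card ?P" by (rule card_inj_on_le[OF inj sub fin])
  then show "card Z \<le> (D + 1) ^ card (- A)" by (simp add: card_PiE)
qed

text \<open>With more elements than monomials of bounded exponents in the variables outside
  \<open>A\<close>, linear algebra gives a nontrivial combination without any such monomial. All its
  monomials then involve a variable in \<open>A\<close>, so it lies in \<open>J\<close>, against
  independence.\<close>

lemma indep_mod_card_le:
  fixes J :: "('n::finite, 'k::field) mpoly set"
  assumes J: "ideal J mpoly_ring" and "finite Y" and indep: "indep_mod J Y \<tau>"
    and A: "\<And>m i. i \<in> A \<Longrightarrow> Poly_Mapping.lookup m i \<noteq> 0 \<Longrightarrow> monomial m \<in> J"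
    and D: "\<And>x. x \<in> Y \<Longrightarrow> exponents_le D (\<tau> x)"
  shows "card Y \<le> (D + 1) ^ card (- A)"
proof (rule ccontr)
  let ?Z = "{m :: 'n \<Rightarrow>\<^sub>0 nat. (\<forall>i\<in>A. Poly_Mapping.lookup m i = 0) \<and> (\<forall>i. Poly_Mapping.lookup m i \<le> D)}"
  assume "\<not> ?thesis"
  then have "card ?Z < card Y" using card_bounded_monomials(2)[of A D] by linarith
  from homogeneous_system_nontrivial_solution[OF card_bounded_monomials(1) assms(2) this,
      of "\<lambda>x. Poly_Mapping.lookup (\<tau> x)"]
  obtain c where c: "\<exists>x\<in>Y. c x \<noteq> 0"
    "\<And>m. m \<in> ?Z \<Longrightarrow> (\<Sum>x\<in>Y. c x * Poly_Mapping.lookup (\<tau> x) m) = 0" by blast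
  let ?p = "\<Sum>x\<in>Y. Poly_Mapping.single 0 (c x) * \<tau> x"
  have look: "Poly_Mapping.lookup ?p m = (\<Sum>x\<in>Y. c x * Poly_Mapping.lookup (\<tau> x) m)" for m
    using lookup_single_mult[of 0 "c x" "\<tau> x" m for x] by (simp add: lookup_sum)
  have "?p \<in> supp_ideal {m. \<exists>i\<in>A. Poly_Mapping.lookup m i \<noteq> 0}"
    unfolding supp_ideal_def
  proof (clarify, rule ccontr)
    fix m assume m: "m \<in> Poly_Mapping.keys ?p" "\<not> (\<exists>i\<in>A. Poly_Mapping.lookup m i \<noteq> 0)"
    then have "(\<Sum>x\<in>Y. c x * Poly_Mapping.lookup (\<tau> x) m) \<noteq> 0" by (simp add: in_keys_iff look)
    then obtain x where "x \<in> Y" "c x * Poly_Mapping.lookup (\<tau> x) m \<noteq> 0"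
      by (rule sum.not_neutral_contains_not_neutral)
    then have "m \<in> ?Z" using m(2) D[of x] by (auto simp: exponents_le_def in_keys_iff)
    with c(2) m(1) show False by (simp add: in_keys_iff look)
  qed
  moreover have "supp_ideal {m. \<exists>i\<in>A. Poly_Mapping.lookup m i \<noteq> 0} \<subseteq> J"
    using A by (intro supp_ideal_subset[OF J]) auto
  ultimately have "?p \<in> J" by (rule subsetD[rotated])
  then have "\<forall>x\<in>Y. c x = 0"
    using indep[unfolded indep_mod_def, THEN spec, of c] by (rule mp[rotated])
  with c(1) show False by blast
qed

lemma exponent_le_of_power_growth:
  fixes r d K :: nat
  assumes "\<And>t. (t + 1) ^ r \<le> (K * t + 1) ^ d"
  shows "r \<le> d"
proof (rule ccontr)
  assume "\<not> r \<le> d"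
  \<comment> \<open>\<open>(K + 1) ^ d\<close> bounds the factor by which the right-hand side
    exceeds \<open>(t + 1) ^ d\<close>. Taken as \<open>t\<close>, it is beaten by the extra factor
    \<open>t + 1\<close> on the left.\<close>
  define t where "t = (K + 1) ^ d"
  have "(t + 1) ^ d * (t + 1) \<le> (t + 1) ^ r"
    using \<open>\<not> r \<le> d\<close> power_increasing[of "Suc d" r "t + 1"] by (simp add: mult.commute)
  also have "\<dots> \<le> (K * t + 1) ^ d" by (rule assms)
  also have "\<dots> \<le> ((K + 1) * (t + 1)) ^ d" by (intro power_mono) (auto simp: algebra_simps)
  also have "\<dots> = (t + 1) ^ d * t" by (simp only: t_def power_mult_distrib mult.commute)
  finally show False by (simp del: power_Suc)
qed

text \<open>The power products with exponents at most \<open>t\<close> are independent modulo the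
  annihilator of \<open>u\<close>, which contains the variables in \<open>A\<close>, and their
  degree in each variable is at most linear in \<open>t\<close>. Counting monomials in the other
  variables and letting \<open>t\<close> grow compares the two exponents.\<close>

lemma length_regular_sequence_le:
  fixes L :: "nat \<Rightarrow> ('n::finite, 'k::field) mpoly set"
  assumes L: "\<And>i. i \<le> length fs \<Longrightarrow> ideal (L i) mpoly_ring" and "ideal I mpoly_ring" "set fs \<subseteq> zero_const"
    and "\<And>i v. i < length fs \<Longrightarrow> v \<in> I \<Longrightarrow> fs ! i * v \<in> L i \<Longrightarrow> v \<in> L i"
    and "\<And>i v. i < length fs \<Longrightarrow> v \<in> L (Suc i) \<Longrightarrow> \<exists>w\<in>I. v - fs ! i * w \<in> L i"
    and "\<And>i v. i < length fs \<Longrightarrow> v \<in> I \<Longrightarrow> fs ! i * v \<in> L (Suc i)"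
    and "\<And>i. i < length fs \<Longrightarrow> L i \<subseteq> L (Suc i)"
    and "u \<in> I" "\<And>g. g * u \<in> L 0 \<Longrightarrow> g \<in> zero_const"
    and A: "\<And>m i. i \<in> A \<Longrightarrow> Poly_Mapping.lookup m i \<noteq> 0 \<Longrightarrow> monomial m * u \<in> L 0"
  shows "length fs \<le> card (- A)"
proof -
  let ?J = "{g. g * u \<in> L 0}"
  have L0: "ideal (L 0) mpoly_ring" using L by simp
  have J: "ideal ?J mpoly_ring"
    unfolding ideal_type_ring_iff
    using type_ideal_zero[OF L0] type_ideal_add[OF L0] type_ideal_mult[OF L0]
    by (auto simp: distrib_right mult.assoc)
  obtain D where D: "\<And>f. f \<in> set fs \<Longrightarrow> exponents_le D f"
    using ex_exponents_le[of "set fs"] by auto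
  have "(t + 1) ^ length fs \<le> (D * length fs * t + 1) ^ card (- A)" for t
  proof -
    let ?Y = "exponents (length fs) t"
    have "indep_mod ?J ?Y (power_prod fs)"
      by (rule regular_sequence_independent[OF assms(1-9)])
    moreover have "finite ?Y" by (rule finite_lists_length_eq) simp
    moreover have "monomial m \<in> ?J" if "i \<in> A" "Poly_Mapping.lookup m i \<noteq> 0" for m i
      using A[OF that] by simp
    moreover have "exponents_le (D * t * length fs) (power_prod fs l)" if "l \<in> ?Y" for l
      by (rule exponents_le_power_prod[OF D that])
    ultimately have "card ?Y \<le> (D * t * length fs + 1) ^ card (- A)"
      by (intro indep_mod_card_le[OF J])
    moreover have "card ?Y = (t + 1) ^ length fs" by (subst card_lists_length_eq) simp_all
    ultimately show ?thesis by (simp only: mult.assoc mult.commute[of t])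
  qed
  then show ?thesis by (rule exponent_le_of_power_growth)
qed


section \<open>Depth of a quotient of ideals\<close>

text \<open>Brings regularity from cosets down to elements. Scalar multiplication on the quotient is
  a union over all representatives; as \<open>a\<close> maps \<open>N\<close> into itself, each of
  them contributes the same coset \<open>N\<close>.\<close>

lemma (in module) nonzerodivisor_on_quotientD:
  assumes N: "subgroup N (add_monoid M)" and smult: "\<forall>n\<in>N. a \<odot>\<^bsub>M\<^esub> n \<in> N"
    and nzd: "nonzerodivisor_on a (quotient_module M N)"
    and a: "a \<in> carrier R" and x: "x \<in> carrier M" "a \<odot>\<^bsub>M\<^esub> x \<in> N"
  shows "x \<in> N"
proof -
  interpret N: abelian_subgroup N M
    by (intro abelian_subgroupI3 additive_subgroupI N M.abelian_group_axioms)
  let ?C = "N +>\<^bsub>M\<^esub> x"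
  have "N +>\<^bsub>M\<^esub> (a \<odot>\<^bsub>M\<^esub> y) = N" if y: "y \<in> ?C" for y
  proof -
    obtain n where n: "n \<in> N" "y = n \<oplus>\<^bsub>M\<^esub> x"
      using y unfolding a_r_coset_def' by blast
    have "a \<odot>\<^bsub>M\<^esub> y = a \<odot>\<^bsub>M\<^esub> n \<oplus>\<^bsub>M\<^esub> a \<odot>\<^bsub>M\<^esub> x"
      unfolding n(2) using a x(1) n(1) by (intro smult_r_distr) auto
    moreover have "a \<odot>\<^bsub>M\<^esub> n \<oplus>\<^bsub>M\<^esub> a \<odot>\<^bsub>M\<^esub> x \<in> N"
      using bspec[OF smult n(1)] x(2) by (rule N.a_closed)
    ultimately have "a \<odot>\<^bsub>M\<^esub> y \<in> N" by (simp only:)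
    then show ?thesis by (rule N.a_rcos_const)
  qed
  then have "(\<Union>y\<in>?C. N +>\<^bsub>M\<^esub> (a \<odot>\<^bsub>M\<^esub> y)) = (\<Union>y\<in>?C. N)" by (rule SUP_cong[OF refl])
  moreover have xC: "x \<in> ?C" by (rule N.a_rcos_self[OF x(1)])
  ultimately have "(\<Union>y\<in>?C. N +>\<^bsub>M\<^esub> (a \<odot>\<^bsub>M\<^esub> y)) = N" by auto
  moreover have "?C \<in> a_rcosets\<^bsub>M\<^esub> N"
    using x(1) N.a_subset by (intro M.a_rcosetsI)
  ultimately have "?C = N"
    using nzd by (simp add: nonzerodivisor_on_def quotient_module_def)
  with xC show ?thesis by simp
qed

section \<open>The quotient module I/J through representatives\<close>

lemma ideal_module_a_r_coset:
  "J +>\<^bsub>ideal_module ring_of_type_algebra I\<^esub> x = (\<lambda>j. j + x) ` J"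
  by (auto simp: ideal_module_def a_r_coset_def')

lemma shift_mem_iff: "z \<in> (\<lambda>j. j + x) ` J \<longleftrightarrow> z - x \<in> (J :: 'a::comm_ring_1 set)"
  by (metis (no_types, lifting) add_diff_cancel_right' diff_add_cancel imageE image_eqI)

lemma shift_eq_iff:
  fixes J :: "'a::comm_ring_1 set"
  assumes J: "ideal J ring_of_type_algebra"
  shows "(\<lambda>j. j + x) ` J = (\<lambda>j. j + y) ` J \<longleftrightarrow> x - y \<in> J"
proof
  assume "(\<lambda>j. j + x) ` J = (\<lambda>j. j + y) ` J"
  moreover have "x \<in> (\<lambda>j. j + x) ` J"
    using type_ideal_zero[OF J] by (simp add: shift_mem_iff)
  ultimately show "x - y \<in> J" by (simp add: shift_mem_iff)
next
  assume xy: "x - y \<in> J"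
  show "(\<lambda>j. j + x) ` J = (\<lambda>j. j + y) ` J"
  proof (rule Set.set_eqI)
    fix z
    show "z \<in> (\<lambda>j. j + x) ` J \<longleftrightarrow> z \<in> (\<lambda>j. j + y) ` J"
      unfolding shift_mem_iff
      using type_ideal_add[OF J _ xy, of "z - x"] type_ideal_diff[OF J _ xy, of "z - y"] by auto
  qed
qed

text \<open>Elements of \<open>M\<close> are handled by representatives in \<open>I\<close>, and
  submodules by their preimages, which are ideals between \<open>J\<close> and
  \<open>I\<close>.\<close>

locale ideal_quotient =
  fixes I J :: "'a::comm_ring_1 set" and M :: "('a, 'a set) module"
  assumes I: "ideal I ring_of_type_algebra" and J: "ideal J ring_of_type_algebra"
    and sub: "J \<subseteq> I"
    and M_def: "M = quotient_module (ideal_module ring_of_type_algebra I) J"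
begin

definition coset :: "'a \<Rightarrow> 'a set" where
  "coset x = (\<lambda>j. j + x) ` J"

lemma coset_eq_iff: "coset x = coset y \<longleftrightarrow> x - y \<in> J"
  unfolding coset_def by (rule shift_eq_iff[OF J])

lemma carrier_M: "carrier M = coset ` I"
  unfolding M_def quotient_module_def A_RCOSETS_def RCOSETS_def coset_def
  by (auto simp: ideal_module_def r_coset_def)

lemma zero_M: "\<zero>\<^bsub>M\<^esub> = coset 0"
  by (simp add: M_def quotient_module_def coset_def)

lemma add_M: "coset x \<oplus>\<^bsub>M\<^esub> coset y = coset (x + y)"
proof -
  have "coset x \<oplus>\<^bsub>M\<^esub> coset y = {a + b | a b. a \<in> coset x \<and> b \<in> coset y}"
    by (auto simp: M_def quotient_module_def ideal_module_def set_add_def')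
  also have "\<dots> = coset (x + y)"
  proof (intro subset_antisym subsetI)
    fix z assume "z \<in> {a + b | a b. a \<in> coset x \<and> b \<in> coset y}"
    then obtain a b where "z = a + b" "a - x \<in> J" "b - y \<in> J"
      by (auto simp: coset_def shift_mem_iff)
    then show "z \<in> coset (x + y)"
      using type_ideal_add[OF J, of "a - x" "b - y"] by (simp add: coset_def shift_mem_iff algebra_simps)
  next
    fix z assume "z \<in> coset (x + y)"
    then have "z = (z - y) + y" "z - y \<in> coset x" "y \<in> coset y"
      using type_ideal_zero[OF J] by (simp_all add: coset_def shift_mem_iff algebra_simps)
    then show "z \<in> {a + b | a b. a \<in> coset x \<and> b \<in> coset y}" by blast
  qed
  finally show ?thesis .
qed

lemma smult_M: "a \<odot>\<^bsub>M\<^esub> coset x = coset (a * x)"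
proof -
  have "a \<odot>\<^bsub>M\<^esub> coset x = (\<Union>z\<in>coset x. coset (a * z))"
    by (simp add: M_def quotient_module_def ideal_module_a_r_coset coset_def)
      (simp add: ideal_module_def)
  moreover have "coset (a * z) = coset (a * x)" if "z \<in> coset x" for z
    using that type_ideal_mult[OF J, of "z - x" a]
    by (simp add: coset_eq_iff) (simp add: coset_def shift_mem_iff right_diff_distrib)
  moreover have "x \<in> coset x"
    using type_ideal_zero[OF J] by (simp add: coset_def shift_mem_iff)
  ultimately show ?thesis by blast
qed

text \<open>The preimage of \<open>(f\<^sub>1, \<dots>, f\<^sub>n) M\<close> in \<open>I\<close>.\<close>

definition lifted_span :: "'a list \<Rightarrow> nat \<Rightarrow> 'a set" where
  "lifted_span fs n = {j + (\<Sum>i<n. fs ! i * w i) | j w. j \<in> J \<and> (\<forall>i. w i \<in> I)}"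

lemma lifted_spanI:
  "j \<in> J \<Longrightarrow> \<forall>i. w i \<in> I \<Longrightarrow> j + (\<Sum>i<n. fs ! i * w i) \<in> lifted_span fs n"
  unfolding lifted_span_def by blast

lemma lifted_spanE:
  assumes "v \<in> lifted_span fs n"
  obtains j w where "v = j + (\<Sum>i<n. fs ! i * w i)" "j \<in> J" "\<forall>i. w i \<in> I"
  using assms unfolding lifted_span_def by blast

lemma ideal_lifted_span: "ideal (lifted_span fs n) ring_of_type_algebra"
  unfolding ideal_type_ring_iff
proof (intro conjI ballI allI)
  show "0 \<in> lifted_span fs n"
    using lifted_spanI[of 0 "\<lambda>_. 0"] type_ideal_zero[OF I] type_ideal_zero[OF J] by simp
next
  fix x y assume xy: "x \<in> lifted_span fs n" "y \<in> lifted_span fs n"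
  obtain j w where x: "x = j + (\<Sum>i<n. fs ! i * w i)" "j \<in> J" "\<forall>i. w i \<in> I"
    using xy(1) by (rule lifted_spanE)
  obtain j' w' where y: "y = j' + (\<Sum>i<n. fs ! i * w' i)" "j' \<in> J" "\<forall>i. w' i \<in> I"
    using xy(2) by (rule lifted_spanE)
  have eq: "x + y = (j + j') + (\<Sum>i<n. fs ! i * (w i + w' i))"
    by (simp add: x(1) y(1) distrib_left sum.distrib algebra_simps)
  show "x + y \<in> lifted_span fs n"
    unfolding eq using x y by (intro lifted_spanI allI type_ideal_add[OF I] type_ideal_add[OF J]) auto
next
  fix x a assume "x \<in> lifted_span fs n"
  then obtain j w where x: "x = j + (\<Sum>i<n. fs ! i * w i)" "j \<in> J" "\<forall>i. w i \<in> I"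
    by (rule lifted_spanE)
  have "a * x = a * j + (\<Sum>i<n. fs ! i * (a * w i))"
    by (simp add: x(1) distrib_left sum_distrib_left mult.left_commute)
  then show "a * x \<in> lifted_span fs n"
    using lifted_spanI[of "a * j" "\<lambda>i. a * w i"] x type_ideal_mult[OF I] type_ideal_mult[OF J]
    by simp
qed

lemma J_subset_lifted_span: "J \<subseteq> lifted_span fs n"
  using lifted_spanI[of _ "\<lambda>_. 0"] type_ideal_zero[OF I] by auto

lemma lifted_span_subset: "lifted_span fs n \<subseteq> I"
proof
  fix v assume "v \<in> lifted_span fs n"
  then obtain j w where "v = j + (\<Sum>i<n. fs ! i * w i)" "j \<in> J" "\<forall>i. w i \<in> I"
    by (rule lifted_spanE)
  then show "v \<in> I"
    using sub by (auto intro!: type_ideal_add[OF I] type_ideal_sum[OF I] type_ideal_mult[OF I])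
qed

text \<open>Provides the division by the next sequence element, modulo the preceding ideal, that
  \<open>annihilator_step\<close> iterates.\<close>

lemma lifted_span_Suc:
  assumes "v \<in> lifted_span fs (Suc n)"
  shows "\<exists>w\<in>I. v - fs ! n * w \<in> lifted_span fs n"
proof -
  obtain j w where v: "v = j + (\<Sum>i<Suc n. fs ! i * w i)" "j \<in> J" "\<forall>i. w i \<in> I"
    using assms by (rule lifted_spanE)
  have "v - fs ! n * w n = j + (\<Sum>i<n. fs ! i * w i)" by (simp add: v(1))
  then show ?thesis using lifted_spanI[OF v(2,3)] v(3) by metis
qed

lemma mult_mem_lifted_span_Suc:
  assumes "v \<in> I"
  shows "fs ! n * v \<in> lifted_span fs (Suc n)"
  using lifted_spanI[of 0 "\<lambda>i. if i = n then v else 0" _ "Suc n"] assms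
    type_ideal_zero[OF I] type_ideal_zero[OF J]
  by simp

lemma lifted_span_mono: "lifted_span fs n \<subseteq> lifted_span fs (Suc n)"
proof
  fix v assume "v \<in> lifted_span fs n"
  then obtain j w where v: "v = j + (\<Sum>i<n. fs ! i * w i)" "j \<in> J" "\<forall>i. w i \<in> I"
    by (rule lifted_spanE)
  then have "v = j + (\<Sum>i<Suc n. fs ! i * (if i < n then w i else 0))" by simp
  then show "v \<in> lifted_span fs (Suc n)"
    using lifted_spanI[of j "\<lambda>i. if i < n then w i else 0" _ "Suc n"] v type_ideal_zero[OF I] by simp
qed

lemma lifted_span_0: "lifted_span fs 0 = J"
  using type_ideal_zero[OF I] by (auto simp: lifted_span_def)

text \<open>The module axioms are a clause of \<open>cohen_macaulay\<close>, so they enter as an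
  assumption here; they justify computing with finite sums in \<open>M\<close>.\<close>

context
  assumes module_M: "module ring_of_type_algebra M"
begin

interpretation M: module ring_of_type_algebra M by (rule module_M)

lemma finsum_M:
  assumes "\<And>i. i < n \<Longrightarrow> w i \<in> I"
  shows "(\<Oplus>\<^bsub>M\<^esub>i\<in>{..<n}. fs ! i \<odot>\<^bsub>M\<^esub> coset (w i)) = coset (\<Sum>i<n. fs ! i * w i)"
  using assms
proof (induction n)
  case 0
  then show ?case by (simp add: zero_M)
next
  case (Suc n)
  have "fs ! i \<odot>\<^bsub>M\<^esub> coset (w i) \<in> carrier M" if "i < Suc n" for i
    using Suc.prems[OF that] by (simp add: smult_M carrier_M type_ideal_mult[OF I])
  then have "(\<Oplus>\<^bsub>M\<^esub>i\<in>{..<Suc n}. fs ! i \<odot>\<^bsub>M\<^esub> coset (w i)) =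
      fs ! n \<odot>\<^bsub>M\<^esub> coset (w n) \<oplus>\<^bsub>M\<^esub> (\<Oplus>\<^bsub>M\<^esub>i\<in>{..<n}. fs ! i \<odot>\<^bsub>M\<^esub> coset (w i))"
    unfolding lessThan_Suc by (intro M.M.finsum_insert) auto
  then show ?case using Suc by (simp add: smult_M add_M add.commute)
qed

lemma list_times_module_take:
  assumes "n \<le> length fs"
  shows "list_times_module (take n fs) M = coset ` lifted_span fs n"
proof (intro subset_antisym subsetI)
  have len: "length (take n fs) = n" using assms by simp
  have eq: "(\<Oplus>\<^bsub>M\<^esub>i\<in>{..<n}. take n fs ! i \<odot>\<^bsub>M\<^esub> coset (w i)) = coset (\<Sum>i<n. fs ! i * w i)"
    if "\<And>i. i < n \<Longrightarrow> w i \<in> I" for w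
    using finsum_M[of n w "take n fs"] that by simp
  {
    fix C assume "C \<in> list_times_module (take n fs) M"
    then obtain x where x: "C = (\<Oplus>\<^bsub>M\<^esub>i\<in>{..<n}. take n fs ! i \<odot>\<^bsub>M\<^esub> x i)" "x \<in> {..<n} \<rightarrow> carrier M"
      unfolding list_times_module_def len by blast
    \<comment> \<open>\<open>lifted_span\<close> asks for a total function into \<open>I\<close>;
      beyond \<open>n\<close> the value 0 serves.\<close>
    have "\<exists>w. w \<in> I \<and> (i < n \<longrightarrow> x i = coset w)" for i
      using x(2) type_ideal_zero[OF I] by (cases "i < n") (auto simp: carrier_M Pi_iff)
    then obtain w where w: "\<forall>i. w i \<in> I" "\<And>i. i < n \<Longrightarrow> x i = coset (w i)" by metis
    have "C = (\<Oplus>\<^bsub>M\<^esub>i\<in>{..<n}. take n fs ! i \<odot>\<^bsub>M\<^esub> coset (w i))"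
      unfolding x(1) using w
      by (intro M.M.finsum_cong') (auto simp: smult_M carrier_M type_ideal_mult[OF I])
    then have "C = coset (0 + (\<Sum>i<n. fs ! i * w i))" using w(1) eq by simp
    then show "C \<in> coset ` lifted_span fs n"
      by (rule image_eqI) (intro lifted_spanI type_ideal_zero[OF J] w(1))
  next
    fix C assume "C \<in> coset ` lifted_span fs n"
    then obtain j w where w: "C = coset (j + (\<Sum>i<n. fs ! i * w i))" "j \<in> J" "\<forall>i. w i \<in> I"
      by (auto elim: lifted_spanE)
    have "coset (j + (\<Sum>i<n. fs ! i * w i)) = coset (\<Sum>i<n. fs ! i * w i)"
      using w(2) by (simp add: coset_eq_iff)
    then have "C = (\<Oplus>\<^bsub>M\<^esub>i\<in>{..<n}. take n fs ! i \<odot>\<^bsub>M\<^esub> coset (w i))"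
      using w eq by simp
    moreover have "(\<lambda>i. coset (w i)) \<in> {..<n} \<rightarrow> carrier M" using w(3) by (auto simp: carrier_M)
    ultimately show "C \<in> list_times_module (take n fs) M"
      unfolding list_times_module_def len
      by (intro CollectI exI[of _ "\<lambda>i. coset (w i)"] conjI)
  }
qed

lemma coset_mem_lifted_span:
  assumes "coset v \<in> coset ` lifted_span fs n"
  shows "v \<in> lifted_span fs n"
proof -
  obtain l where l: "l \<in> lifted_span fs n" "v - l \<in> J"
    using assms by (auto simp: coset_eq_iff)
  then show ?thesis
    using type_ideal_add[OF ideal_lifted_span l(1)] J_subset_lifted_span by force
qed

lemma regular_sequence_lifted:
  assumes reg: "regular_sequence fs M" and n: "n < length fs" and v: "v \<in> I" "fs ! n * v \<in> lifted_span fs n"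
  shows "v \<in> lifted_span fs n"
proof -
  let ?N = "coset ` lifted_span fs n"
  note lift = ideal_lifted_span[of fs n]
  have nzd: "nonzerodivisor_on (fs ! n) (quotient_module M ?N)"
    using reg n by (simp add: regular_sequence_def list_times_module_take)
  have subgroup: "subgroup ?N (add_monoid M)"
  proof
    show "?N \<subseteq> carrier (add_monoid M)" using lifted_span_subset by (auto simp: carrier_M)
    show "\<one>\<^bsub>add_monoid M\<^esub> \<in> ?N" using type_ideal_zero[OF lift] by (simp add: zero_M)
    show "x \<otimes>\<^bsub>add_monoid M\<^esub> y \<in> ?N" if "x \<in> ?N" "y \<in> ?N" for x y
      using that type_ideal_add[OF lift] by (auto simp: add_M)
    show "inv\<^bsub>add_monoid M\<^esub> x \<in> ?N" if x: "x \<in> ?N" for x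
    proof -
      obtain l where l: "x = coset l" "l \<in> lifted_span fs n" using x by blast
      have "- l \<in> lifted_span fs n" using type_ideal_mult[OF lift l(2), of "-1"] by simp
      moreover from this have "\<ominus>\<^bsub>M\<^esub> x = coset (- l)"
        using l lifted_span_subset by (intro M.M.minus_equality) (auto simp: add_M zero_M carrier_M)
      ultimately show ?thesis by (simp add: a_inv_def)
    qed
  qed
  have smult: "\<forall>C\<in>?N. fs ! n \<odot>\<^bsub>M\<^esub> C \<in> ?N"
    using type_ideal_mult[OF lift] by (auto simp: smult_M)
  have "fs ! n \<in> carrier ring_of_type_algebra" "coset v \<in> carrier M"
    "fs ! n \<odot>\<^bsub>M\<^esub> coset v \<in> ?N"
    using v by (simp_all add: carrier_M smult_M)
  then have "coset v \<in> ?N"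
    by (rule M.nonzerodivisor_on_quotientD[OF subgroup smult nzd])
  then show ?thesis by (rule coset_mem_lifted_span)
qed

end

lemma annihilator_M: "annihilator ring_of_type_algebra M = {a. \<forall>x\<in>I. a * x \<in> J}"
  by (auto simp: annihilator_def carrier_M zero_M smult_M coset_eq_iff)

end

lemma irrelevant_ideal_subset: "irrelevant_ideal \<subseteq> (zero_const :: ('n::finite, 'k::field) mpoly set)"
proof -
  interpret R: cring "mpoly_ring :: ('n, 'k) mpoly ring" by (rule cring_from_type_algebra)
  have "ideal (zero_const :: ('n, 'k) mpoly set) mpoly_ring"
    by (auto simp: ideal_type_ring_iff zero_const_def lookup_add lookup_mult_0)
  moreover have "variable i \<in> (zero_const :: ('n, 'k) mpoly set)" for i
  proof -
    have "Poly_Mapping.single i (1 :: nat) \<noteq> 0"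
      by (metis lookup_single_eq lookup_zero zero_neq_one)
    then show ?thesis by (simp add: zero_const_def variable_def monomial_def lookup_single when_def)
  qed
  ultimately show ?thesis
    unfolding irrelevant_ideal_def by (intro R.genideal_minimal) auto
qed

text \<open>The preimages \<open>lifted_span fs i\<close> form the chain of ideals
  \<open>L i\<close> required by the counting bound, starting at \<open>J\<close>, and that bound
  applies to every regular sequence in the irrelevant ideal.\<close>

lemma depth_ideal_quotient_le:
  fixes I J :: "('n::finite, 'k::field) mpoly set"
  assumes I: "ideal I mpoly_ring" and J: "ideal J mpoly_ring" and sub: "J \<subseteq> I"
    and M: "module mpoly_ring (quotient_module (ideal_module mpoly_ring I) J)"
    and u: "u \<in> I" "\<And>g. g * u \<in> J \<Longrightarrow> g \<in> zero_const"
    and A: "\<And>m i. i \<in> A \<Longrightarrow> Poly_Mapping.lookup m i \<noteq> 0 \<Longrightarrow> monomial m * u \<in> J"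
  shows "depth irrelevant_ideal (quotient_module (ideal_module mpoly_ring I) J) \<le> card (- A)"
  unfolding depth_def
proof (rule SUP_least)
  interpret ideal_quotient I J "quotient_module (ideal_module mpoly_ring I) J"
    by (rule ideal_quotient.intro[OF I J sub refl])
  fix fs :: "('n, 'k) mpoly list"
  assume "fs \<in> {fs. set fs \<subseteq> irrelevant_ideal \<and>
    regular_sequence fs (quotient_module (ideal_module mpoly_ring I) J)}"
  then have fs: "set fs \<subseteq> zero_const"
    "regular_sequence fs (quotient_module (ideal_module mpoly_ring I) J)"
    using irrelevant_ideal_subset by auto
  have "length fs \<le> card (- A)"
  proof (rule length_regular_sequence_le[OF ideal_lifted_span I fs(1)])
    show "v \<in> lifted_span fs i" if "i < length fs" "v \<in> I" "fs ! i * v \<in> lifted_span fs i" for i v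
      by (rule regular_sequence_lifted[OF M fs(2) that])
    show "\<exists>w\<in>I. v - fs ! i * w \<in> lifted_span fs i" if "v \<in> lifted_span fs (Suc i)" for i v
      by (rule lifted_span_Suc[OF that])
    show "fs ! i * v \<in> lifted_span fs (Suc i)" if "v \<in> I" for i v
      by (rule mult_mem_lifted_span_Suc[OF that])
    show "lifted_span fs i \<subseteq> lifted_span fs (Suc i)" for i by (rule lifted_span_mono)
    show "g \<in> zero_const" if "g * u \<in> lifted_span fs 0" for g
      using that u(2) by (simp add: lifted_span_0)
    show "monomial m * u \<in> lifted_span fs 0" if "i \<in> A" "Poly_Mapping.lookup m i \<noteq> 0" for m i
      using A[OF that] by (simp add: lifted_span_0)
  qed (rule u(1))
  then show "enat (length fs) \<le> enat (card (- A))" by simp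
qed


section \<open>Chains of monomial primes\<close>

text \<open>A prime containing \<open>K\<close> is a union of cosets of \<open>K\<close>, so
  membership can be tested on any representative. Hence the images in the quotient stay prime and
  strictly nested.\<close>

lemma krull_dim_quotient_ge:
  assumes K: "ideal K R" and R: "cring R" and ne: "Ps \<noteq> []" and sorted: "sorted_wrt (\<subset>) Ps"
    and Ps: "\<And>P. P \<in> set Ps \<Longrightarrow> primeideal P R \<and> K \<subseteq> P"
  shows "enat (length Ps - 1) \<le> krull_dim (R Quot K)"
proof -
  interpret R: cring R by (rule R)
  interpret K: ideal K R by (rule K)
  let ?h = "\<lambda>P. (+>\<^bsub>R\<^esub>) K ` P"
  have mem: "x \<in> P" if P: "P \<in> set Ps" and x: "x \<in> carrier R" "K +>\<^bsub>R\<^esub> x \<in> ?h P" for P x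
  proof -
    interpret P: primeideal P R using Ps[OF P] by simp
    obtain y where y: "y \<in> P" "K +>\<^bsub>R\<^esub> x = K +>\<^bsub>R\<^esub> y" using x(2) by blast
    then have "x \<in> K +>\<^bsub>R\<^esub> y" using K.a_rcos_self[OF x(1)] by simp
    then obtain k where "k \<in> K" "x = k \<oplus>\<^bsub>R\<^esub> y" unfolding a_r_coset_def' by blast
    then show ?thesis using Ps[OF P] y(1) by (metis P.a_closed subsetD)
  qed
  have prime: "primeideal (?h P) (R Quot K)" if P: "P \<in> set Ps" for P
  proof -
    interpret P: primeideal P R using Ps[OF P] by simp
    show ?thesis
    proof (rule primeidealI)
      show "ideal (?h P) (R Quot K)" by (rule R.ring_ideal_imp_quot_ideal[OF K P.ideal_axioms])
      show "cring (R Quot K)" by (rule K.quotient_is_cring[OF R])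
      show "carrier (R Quot K) \<noteq> ?h P"
      proof
        assume "carrier (R Quot K) = ?h P"
        then have "K +>\<^bsub>R\<^esub> \<one>\<^bsub>R\<^esub> \<in> ?h P"
          by (metis K.rcos_ring_hom R.one_closed ring_hom_closed)
        then have "\<one>\<^bsub>R\<^esub> \<in> P" by (rule mem[OF P R.one_closed])
        then show False using P.I_notcarr P.one_imp_carrier by simp
      qed
      fix a b assume ab: "a \<in> carrier (R Quot K)" "b \<in> carrier (R Quot K)" "a \<otimes>\<^bsub>R Quot K\<^esub> b \<in> ?h P"
      obtain x y where x: "x \<in> carrier R" "a = K +>\<^bsub>R\<^esub> x" and y: "y \<in> carrier R" "b = K +>\<^bsub>R\<^esub> y"
        using ab(1,2) by (auto simp: FactRing_simps)
      have "K +>\<^bsub>R\<^esub> (x \<otimes>\<^bsub>R\<^esub> y) \<in> ?h P"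
        using ab(3) ring_hom_mult[OF K.rcos_ring_hom x(1) y(1)] x(2) y(2) by simp
      then have "x \<otimes>\<^bsub>R\<^esub> y \<in> P" using x y by (intro mem[OF P]) auto
      then show "a \<in> ?h P \<or> b \<in> ?h P" using P.I_prime[OF x(1) y(1)] x(2) y(2) by blast
    qed
  qed
  have strict: "?h P \<subset> ?h Q" if PQ: "P \<in> set Ps" "Q \<in> set Ps" "P \<subset> Q" for P Q
  proof -
    obtain x where x: "x \<in> Q" "x \<notin> P" using PQ(3) by blast
    interpret Q: primeideal Q R using Ps[OF PQ(2)] by simp
    have "K +>\<^bsub>R\<^esub> x \<notin> ?h P" using mem[OF PQ(1) Q.Icarr[OF x(1)]] x(2) by blast
    then show ?thesis using PQ(3) x(1) by blast
  qed
  have "sorted_wrt (\<subset>) (map ?h Ps)"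
    unfolding sorted_wrt_map by (rule sorted_wrt_mono_rel[OF strict sorted])
  then have "map ?h Ps \<in> {Ps. Ps \<noteq> [] \<and> (\<forall>P \<in> set Ps. primeideal P (R Quot K)) \<and> sorted_wrt (\<subset>) Ps}"
    using ne prime by simp
  then have "enat (length (map ?h Ps) - 1) \<le> krull_dim (R Quot K)"
    unfolding krull_dim_def by (rule SUP_upper)
  then show ?thesis by simp
qed

text \<open>The exponents of the monomials in the prime \<open>P_B\<close> generated by the
  variables in \<open>B\<close>.\<close>

definition var_monomials :: "'n::finite set \<Rightarrow> ('n \<Rightarrow>\<^sub>0 nat) set" where
  "var_monomials B = {m. \<exists>i\<in>B. Poly_Mapping.lookup m i \<noteq> 0}"

lemma var_monomials_mono: "B \<subseteq> C \<Longrightarrow> var_monomials B \<subseteq> var_monomials C"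
  unfolding var_monomials_def by blast

lemma supp_ideal_mono: "U \<subseteq> V \<Longrightarrow> supp_ideal U \<subseteq> supp_ideal V"
  unfolding supp_ideal_def by blast

lemma upclosed_var_monomials: "upclosed (var_monomials B)"
  by (auto simp: upclosed_def var_monomials_def lookup_add)

text \<open>Modulo the ideal each factor may be replaced by its part free of the variables in
  \<open>B\<close>. The product of two nonzero such parts is nonzero and again free of them, so it
  cannot lie in the ideal.\<close>

lemma primeideal_var_monomials:
  "primeideal (supp_ideal (var_monomials B) :: ('n::finite, 'k::field) mpoly set) mpoly_ring"
proof -
  let ?V = "var_monomials B"
  let ?P = "supp_ideal ?V :: ('n, 'k) mpoly set"
  have P: "ideal ?P mpoly_ring" by (rule ideal_supp_ideal[OF upclosed_var_monomials])
  have split: "\<exists>p0. p - p0 \<in> ?P \<and> Poly_Mapping.keys p0 \<inter> ?V = {}" for p :: "('n, 'k) mpoly"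
  proof (intro exI conjI)
    let ?t = "\<lambda>m. Poly_Mapping.single m (Poly_Mapping.lookup p m)"
    let ?p0 = "\<Sum>m\<in>Poly_Mapping.keys p - ?V. ?t m"
    have "p = (\<Sum>m\<in>Poly_Mapping.keys p. ?t m)"
      by (subst mpoly_expansion[of p]) (simp add: monomial_def mult_single)
    also have "\<dots> = (\<Sum>m\<in>Poly_Mapping.keys p \<inter> ?V. ?t m) + ?p0"
      by (rule sum.Int_Diff) simp
    finally have "p - ?p0 = (\<Sum>m\<in>Poly_Mapping.keys p \<inter> ?V. ?t m)" by (simp add: algebra_simps)
    moreover have "\<dots> \<in> ?P"
      by (rule type_ideal_sum[OF P]) (auto simp: supp_ideal_def)
    ultimately show "p - ?p0 \<in> ?P" by (simp only:)
    have "Poly_Mapping.keys ?p0 \<subseteq> (\<Union>m\<in>Poly_Mapping.keys p - ?V. Poly_Mapping.keys (?t m))"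
      by (rule keys_sum)
    also have "\<dots> \<subseteq> Poly_Mapping.keys p - ?V" by auto
    finally show "Poly_Mapping.keys ?p0 \<inter> ?V = {}" by blast
  qed
  have "p \<in> ?P \<or> q \<in> ?P" if pq: "p * q \<in> ?P" for p q :: "('n, 'k) mpoly"
  proof (rule ccontr)
    assume no: "\<not> ?thesis"
    obtain p0 where p0: "p - p0 \<in> ?P" "Poly_Mapping.keys p0 \<inter> ?V = {}" using split by blast
    obtain q0 where q0: "q - q0 \<in> ?P" "Poly_Mapping.keys q0 \<inter> ?V = {}" using split by blast
    have "p0 \<noteq> 0" "q0 \<noteq> 0" using no p0(1) q0(1) by auto
    then have "p0 * q0 \<noteq> 0" by (rule mpoly_mult_nonzero)
    moreover have "p0 * q0 \<in> ?P"
    proof -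
      have "p * q - (q * (p - p0) + p0 * (q - q0)) \<in> ?P"
        by (intro type_ideal_diff[OF P pq] type_ideal_add[OF P] type_ideal_mult[OF P] p0(1) q0(1))
      then show ?thesis by (simp add: algebra_simps)
    qed
    moreover have "Poly_Mapping.keys (p0 * q0) \<inter> ?V = {}"
    proof -
      have "a + b \<notin> ?V" if "a \<in> Poly_Mapping.keys p0" "b \<in> Poly_Mapping.keys q0" for a b
      proof -
        have "a \<notin> ?V" "b \<notin> ?V" using that p0(2) q0(2) by blast+
        then show ?thesis by (simp add: var_monomials_def lookup_add)
      qed
      then show ?thesis using keys_mult[of p0 q0] by blast
    qed
    ultimately have "Poly_Mapping.keys (p0 * q0) = {}" unfolding supp_ideal_def by blast
    then show False using \<open>p0 * q0 \<noteq> 0\<close> by simp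
  qed
  moreover have "1 \<notin> ?P" by (simp add: supp_ideal_def var_monomials_def)
  ultimately show ?thesis using P by (simp add: primeideal_type_ring_iff)
qed

lemma variable_mem_var_ideal:
  "(variable i :: ('n::finite, 'k::field) mpoly) \<in> supp_ideal (var_monomials B) \<longleftrightarrow> i \<in> B"
  by (auto simp: variable_def var_monomials_def lookup_single when_def)

text \<open>Adjoining the variables outside \<open>B\<close> one at a time to the prime of
  \<open>B\<close> gives a strict chain with \<open>card (- B) + 1\<close> members, all containing
  \<open>K\<close>.\<close>

lemma krull_dim_quotient_ge_card:
  fixes K :: "('n::finite, 'k::field) mpoly set"
  assumes K: "ideal K mpoly_ring" and sub: "K \<subseteq> supp_ideal (var_monomials B)"
  shows "card (- B) \<le> krull_dim (mpoly_ring Quot K)"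
proof -
  obtain xs where xs: "set xs = - B" "distinct xs"
    using finite_distinct_list[of "- B"] by auto
  let ?C = "\<lambda>k. B \<union> set (take k xs)"
  let ?P = "\<lambda>k. supp_ideal (var_monomials (?C k)) :: ('n, 'k) mpoly set"
  let ?Ps = "map ?P [0..<Suc (length xs)]"
  have strict: "?P j \<subset> ?P k" if "j < k" "k \<le> length xs" for j k
  proof -
    have "?C j \<subseteq> ?C k" using that set_take_subset_set_take[of j k xs] by auto
    then have "?P j \<subseteq> ?P k" by (intro supp_ideal_mono var_monomials_mono)
    have xj: "xs ! j \<in> set (take k xs)" using that by (auto simp: in_set_conv_nth)
    have "xs ! j \<notin> set (take j xs)"
      using that xs(2) by (auto simp: in_set_conv_nth nth_eq_iff_index_eq)
    moreover have "xs ! j \<notin> B" using that xs(1) nth_mem[of j xs] by auto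
    ultimately have "variable (xs ! j) \<in> ?P k" "variable (xs ! j) \<notin> ?P j"
      using xj by (simp_all add: variable_mem_var_ideal)
    with \<open>?P j \<subseteq> ?P k\<close> show ?thesis by blast
  qed
  have sorted: "sorted_wrt (\<subset>) ?Ps"
    unfolding sorted_wrt_map
  proof (rule sorted_wrt_mono_rel[OF _ sorted_wrt_upt])
    fix j k assume "k \<in> set [0..<Suc (length xs)]" "j < k"
    then show "?P j \<subset> ?P k" by (intro strict) auto
  qed
  have "K \<subseteq> ?P k" for k
    by (rule order_trans[OF sub]) (intro supp_ideal_mono var_monomials_mono Un_upper1)
  then have "primeideal P mpoly_ring \<and> K \<subseteq> P" if "P \<in> set ?Ps" for P
    using that primeideal_var_monomials unfolding set_map by blast
  then have "enat (length ?Ps - 1) \<le> krull_dim (mpoly_ring Quot K)"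
    by (intro krull_dim_quotient_ge[OF K cring_from_type_algebra _ sorted]) simp_all
  moreover have "length xs = card (- B)" using xs distinct_card by metis
  ultimately show ?thesis by simp
qed


section \<open>Embedded components of the square\<close>

text \<open>Vertex covers of the hypergraph whose edges are the supports of the vectors in
  \<open>E\<close>: \<open>B\<close> is a cover exactly if the prime \<open>P_B\<close> contains the
  ideal generated by \<open>E\<close>.\<close>

definition cover :: "('n::finite \<Rightarrow>\<^sub>0 nat) set \<Rightarrow> 'n set \<Rightarrow> bool" where
  "cover E B \<longleftrightarrow> E \<subseteq> var_monomials B"

definition minimal_cover :: "('n::finite \<Rightarrow>\<^sub>0 nat) set \<Rightarrow> 'n set \<Rightarrow> bool" where
  "minimal_cover E B \<longleftrightarrow> cover E B \<and> (\<forall>C. cover E C \<and> C \<subseteq> B \<longrightarrow> C = B)"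

lemma ex_minimal_cover:
  assumes "cover E (C :: 'n::finite set)"
  obtains B where "minimal_cover E B" "B \<subseteq> C"
proof -
  have "finite {B. cover E B \<and> B \<subseteq> C}" by simp
  from finite_has_minimal2[OF this, of C] assms
  obtain B where B: "B \<in> {B. cover E B \<and> B \<subseteq> C}" "B \<subseteq> C"
    "\<forall>D\<in>{B. cover E B \<and> B \<subseteq> C}. D \<subseteq> B \<longrightarrow> B = D" by auto
  then have "minimal_cover E B" unfolding minimal_cover_def by blast
  then show ?thesis using B(2) by (rule that)
qed

text \<open>Removing \<open>i\<close> from a minimal cover leaves some generator uncovered; among
  the variables in \<open>B\<close> that generator involves only \<open>i\<close>.\<close>

lemma minimal_cover_private:
  assumes "minimal_cover E B" "i \<in> B"
  obtains e where "e \<in> E" "Poly_Mapping.lookup e i \<noteq> 0"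
    "\<And>j. j \<in> B \<Longrightarrow> j \<noteq> i \<Longrightarrow> Poly_Mapping.lookup e j = 0"
proof -
  have "\<not> cover E (B - {i})" using assms unfolding minimal_cover_def by blast
  then obtain e where e: "e \<in> E" "e \<notin> var_monomials (B - {i})" unfolding cover_def by blast
  have "e \<in> var_monomials B" using assms(1) e(1) unfolding minimal_cover_def cover_def by blast
  then show ?thesis using e that[of e] unfolding var_monomials_def by blast
qed

lemma upset_le:
  fixes m :: "'a \<Rightarrow>\<^sub>0 nat"
  assumes "e \<in> E" "\<And>i. Poly_Mapping.lookup e i \<le> Poly_Mapping.lookup m i"
  shows "m \<in> upset E"
proof -
  have "m = e + (m - e)"
    using assms(2) by (intro poly_mapping_eqI) (simp add: lookup_add lookup_minus)
  then show ?thesis using assms(1) unfolding upset_def by blast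
qed

lemma upset_subset_var_monomials: "cover E B \<Longrightarrow> upset E \<subseteq> var_monomials B"
  unfolding cover_def upset_def using upclosed_var_monomials[of B] unfolding upclosed_def by blast

text \<open>For a prime \<open>Q\<close> between the two ideals, the variables lying in
  \<open>Q\<close> form a cover inside \<open>B\<close>. By minimality they are all of
  \<open>B\<close>, and so \<open>Q\<close> contains the generators of the prime of
  \<open>B\<close>.\<close>

lemma minimal_prime_minimal_cover:
  assumes sqf: "\<And>m i. m \<in> E \<Longrightarrow> Poly_Mapping.lookup m i \<le> 1" and B: "minimal_cover E B"
  shows "supp_ideal (var_monomials B) \<in>
    minimal_primes mpoly_ring (supp_ideal (upset E) :: ('n::finite, 'k::field) mpoly set)"
  unfolding minimal_primes_def
proof (intro CollectI conjI allI impI)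
  let ?P = "supp_ideal (var_monomials B) :: ('n, 'k) mpoly set"
  let ?I = "supp_ideal (upset E) :: ('n, 'k) mpoly set"
  show "primeideal ?P mpoly_ring" by (rule primeideal_var_monomials)
  have cov: "cover E B" using B by (simp add: minimal_cover_def)
  show "?I \<subseteq> ?P"
    using upset_subset_var_monomials[OF cov] by (auto simp: supp_ideal_def)
  fix Q assume Q: "primeideal Q mpoly_ring \<and> ?I \<subseteq> Q \<and> Q \<subseteq> ?P"
  have Qid: "ideal Q mpoly_ring" and Q1: "1 \<notin> Q"
    and Qpr: "\<And>x y. x * y \<in> Q \<Longrightarrow> x \<in> Q \<or> y \<in> Q"
    using Q by (auto simp: primeideal_type_ring_iff)
  define C where "C = {i. (variable i :: ('n, 'k) mpoly) \<in> Q}"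
  have "C \<subseteq> B"
  proof
    fix i assume "i \<in> C"
    then have "(variable i :: ('n, 'k) mpoly) \<in> ?P" using Q unfolding C_def by blast
    then show "i \<in> B" by (simp add: variable_mem_var_ideal)
  qed
  moreover have "cover E C"
    unfolding cover_def
  proof
    fix e assume e: "e \<in> E"
    have eQ: "(monomial e :: ('n, 'k) mpoly) \<in> Q"
      using Q upset_self[OF e] monomial_mem_supp_ideal by blast
    \<comment> \<open>Squarefreeness makes the generator a product of distinct variables, one of
      which the prime \<open>Q\<close> must contain.\<close>
    have e_sum: "e = (\<Sum>i\<in>{i. Poly_Mapping.lookup e i \<noteq> 0}. Poly_Mapping.single i 1)"
    proof (rule poly_mapping_eqI)
      fix j
      have "Poly_Mapping.lookup e j = 0 \<or> Poly_Mapping.lookup e j = 1"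
        using sqf[OF e, of j] by linarith
      then show "Poly_Mapping.lookup e j =
          Poly_Mapping.lookup (\<Sum>i\<in>{i. Poly_Mapping.lookup e i \<noteq> 0}. Poly_Mapping.single i 1) j"
        by (auto simp: lookup_sum lookup_single when_def)
    qed
    have factor: "\<exists>i\<in>F. (variable i :: ('n, 'k) mpoly) \<in> Q"
      if "(monomial (\<Sum>i\<in>F. Poly_Mapping.single i 1) :: ('n, 'k) mpoly) \<in> Q" for F :: "'n set"
      using finite[of F] that
    proof (induction F rule: finite_induct)
      case empty
      then show ?case using Q1 by (simp add: monomial_def)
    next
      case (insert j F)
      then have "(variable j * monomial (\<Sum>i\<in>F. Poly_Mapping.single i 1) :: ('n, 'k) mpoly) \<in> Q"
        by (simp add: variable_def monomial_mult)
      from Qpr[OF this] insert.IH show ?case by blast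
    qed
    have "\<exists>i\<in>{i. Poly_Mapping.lookup e i \<noteq> 0}. (variable i :: ('n, 'k) mpoly) \<in> Q"
      by (rule factor) (simp only: e_sum[symmetric] eQ)
    then show "e \<in> var_monomials C" by (auto simp: var_monomials_def C_def)
  qed
  ultimately have C: "C = B" using B by (simp add: minimal_cover_def)
  have "?P \<subseteq> Q"
  proof (rule supp_ideal_subset[OF Qid])
    fix m assume "m \<in> var_monomials B"
    then obtain i where i: "i \<in> B" "Poly_Mapping.lookup m i \<noteq> 0" by (auto simp: var_monomials_def)
    have "m = (m - Poly_Mapping.single i 1) + Poly_Mapping.single i 1"
      using i(2) by (intro poly_mapping_eqI) (auto simp: lookup_add lookup_minus lookup_single when_def)
    then have "(monomial m :: ('n, 'k) mpoly) = monomial (m - Poly_Mapping.single i 1) * variable i"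
      by (simp add: variable_def monomial_mult)
    moreover have "(variable i :: ('n, 'k) mpoly) \<in> Q" using i(1) C by (auto simp: C_def)
    ultimately show "(monomial m :: ('n, 'k) mpoly) \<in> Q" using type_ideal_mult[OF Qid] by simp
  qed
  with Q show "Q = ?P" by blast
qed

text \<open>A monomial in the symbolic square but not in the square, multiplied so as to have as many
  variables as possible in its annihilator modulo the square, generates an embedded component.\<close>

lemma embedded_component:
  fixes E :: "('n::finite \<Rightarrow>\<^sub>0 nat) set"
  defines "U \<equiv> upset E"
  assumes sqf: "\<And>m i. m \<in> E \<Longrightarrow> Poly_Mapping.lookup m i \<le> 1"
    and w0: "w0 \<notin> sumset U U" "\<And>B. minimal_cover E B \<Longrightarrow> w0 \<in> sumset (var_monomials B) (var_monomials B)"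
  obtains w A B where "w \<in> U" "w \<notin> sumset U U" "\<And>m. m \<in> var_monomials A \<Longrightarrow> m + w \<in> sumset U U"
    "minimal_cover E B" "B \<subset> A"
proof -
  let ?W = "sumset U U"
  let ?S = "\<lambda>B. sumset (var_monomials B) (var_monomials B)"
  let ?Q = "{w. w \<notin> ?W \<and> (\<forall>B. minimal_cover E B \<longrightarrow> w \<in> ?S B)}"
  let ?A = "\<lambda>w. {i. w + Poly_Mapping.single i 1 \<in> ?W}"
  have upW: "upclosed ?W" unfolding U_def by (intro upclosed_sumset upclosed_upset)
  have up: "m + d \<in> ?W" if "m \<in> ?W" for m d using upW that by (simp add: upclosed_def)
  have "w0 \<in> ?Q" using w0 by blast
  moreover have "\<forall>w. w \<in> ?Q \<longrightarrow> card (?A w) < Suc (card (UNIV :: 'n set))"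
    by (auto simp: less_Suc_eq_le intro: card_mono)
  ultimately obtain w where w: "w \<in> ?Q" "\<And>v. v \<in> ?Q \<Longrightarrow> card (?A v) \<le> card (?A w)"
    using ex_has_greatest_nat[of "\<lambda>w. w \<in> ?Q" w0 "\<lambda>w. card (?A w)"] by blast
  define A where "A = ?A w"
  \<comment> \<open>Multiplying by a variable outside \<open>A\<close> yields another candidate
    whose set of annihilating variables contains \<open>A\<close>, hence equals \<open>A\<close> by
    maximality. So no monomial in the variables outside \<open>A\<close> moves \<open>w\<close> into
    the square.\<close>
  have grow: "w + z \<notin> ?W" if "\<And>i. i \<in> A \<Longrightarrow> Poly_Mapping.lookup z i = 0" for z
    using that
  proof (induction "\<Sum>i\<in>UNIV. Poly_Mapping.lookup z i" arbitrary: z)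
    case 0
    then have "z = 0" by (intro poly_mapping_eqI) simp
    then show ?case using w(1) by simp
  next
    case (Suc n)
    obtain i where i: "Poly_Mapping.lookup z i \<noteq> 0"
      using Suc.hyps(2) by (metis nat.distinct(1) sum.neutral)
    define z' where "z' = z - Poly_Mapping.single i 1"
    have z: "z = z' + Poly_Mapping.single i 1"
      unfolding z'_def using i by (intro poly_mapping_eqI) (auto simp: lookup_add lookup_minus lookup_single when_def)
    have "(\<Sum>i\<in>UNIV. Poly_Mapping.lookup z i) = (\<Sum>i\<in>UNIV. Poly_Mapping.lookup z' i) + 1"
      by (simp add: z lookup_add sum.distrib lookup_single when_def)
    then have "w + z' \<notin> ?W"
      using Suc by (intro Suc.hyps(1)) (auto simp: z'_def lookup_minus)
    moreover have "w + z' \<in> ?S B" if "minimal_cover E B" for B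
      using w(1) that upclosed_sumset[OF upclosed_var_monomials[of B], of "var_monomials B"]
      unfolding upclosed_def by blast
    ultimately have "w + z' \<in> ?Q" by blast
    then have "card (?A (w + z')) \<le> card A" unfolding A_def by (rule w(2))
    moreover have "A \<subseteq> ?A (w + z')"
      unfolding A_def using up[of "w + Poly_Mapping.single j 1" z' for j] by (auto simp: add_ac)
    ultimately have "?A (w + z') = A" using card_seteq[of "?A (w + z')" A] by simp
    moreover have "i \<notin> A" using Suc.prems[of i] i by (rule contrapos_nn[rotated])
    ultimately have "w + z' + Poly_Mapping.single i 1 \<notin> ?W" by blast
    then show ?case by (simp only: z add.assoc not_False_eq_True)
  qed
  have covA: "cover E A"
    unfolding cover_def
  proof (rule subsetI, rule ccontr)
    fix e assume e: "e \<in> E" "e \<notin> var_monomials A"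
    \<comment> \<open>The square of a generator avoiding \<open>A\<close> would move
      \<open>w\<close> into the square of the ideal using only variables outside
      \<open>A\<close>.\<close>
    have "e + e \<in> ?W" using upset_self[OF e(1)] unfolding sumset_def U_def by blast
    then have "w + (e + e) \<in> ?W" using up by (simp add: add.commute[of w])
    moreover have "w + (e + e) \<notin> ?W"
      using e(2) by (intro grow) (auto simp: var_monomials_def lookup_add)
    ultimately show False by blast
  qed
  have not_min: "\<not> minimal_cover E A"
  proof
    assume min: "minimal_cover E A"
    then obtain a b where ab: "w = a + b" "a \<in> var_monomials A" "b \<in> var_monomials A"
      using w(1) unfolding sumset_def by blast
    \<comment> \<open>Multiplying by the product of all variables outside \<open>A\<close> imitates
      localizing at the prime of \<open>A\<close>. For a minimal cover, a multiple of a variable in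
      \<open>A\<close> is thereby moved into \<open>U\<close>: some squarefree generator meets
      \<open>A\<close> in that variable alone. Both factors of \<open>w\<close> end up in
      \<open>U\<close>.\<close>
    define s where "s = (\<Sum>k\<in>- A. Poly_Mapping.single k (1::nat))"
    have s: "Poly_Mapping.lookup s k = (if k \<in> A then 0 else 1)" for k
      by (auto simp: s_def lookup_sum lookup_single when_def)
    have "c + s \<in> U" if c: "c \<in> var_monomials A" for c
    proof -
      obtain i where i: "i \<in> A" "Poly_Mapping.lookup c i \<noteq> 0"
        using c by (auto simp: var_monomials_def)
      obtain e where e: "e \<in> E" "\<And>j. j \<in> A \<Longrightarrow> j \<noteq> i \<Longrightarrow> Poly_Mapping.lookup e j = 0"
        by (rule minimal_cover_private[OF min i(1)]) blast
      have "Poly_Mapping.lookup e k \<le> Poly_Mapping.lookup (c + s) k" for k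
        using sqf[OF e(1), of k] e(2)[of k] i by (cases "k \<in> A"; cases "k = i") (auto simp: lookup_add s)
      then show ?thesis unfolding U_def by (rule upset_le[OF e(1)])
    qed
    then have "(a + s) + (b + s) \<in> ?W" using ab(2,3) unfolding sumset_def by blast
    moreover have "w + (s + s) \<notin> ?W" by (rule grow) (simp add: lookup_add s)
    ultimately show False by (simp add: ab(1) add_ac)
  qed
  obtain B where B: "minimal_cover E B" "B \<subseteq> A" by (rule ex_minimal_cover[OF covA])
  have "w \<in> U"
  proof (rule ccontr)
    assume wU: "w \<notin> U"
    \<comment> \<open>A squarefree generator avoiding the variables absent from \<open>w\<close>
      would divide \<open>w\<close>. If \<open>w\<close> is not in \<open>U\<close>, these variables
      therefore contain a minimal cover, whose prime does not contain \<open>w\<close>.\<close>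
    let ?C = "{i. Poly_Mapping.lookup w i = 0}"
    have "cover E ?C"
      unfolding cover_def
    proof (rule subsetI, rule ccontr)
      fix e assume e: "e \<in> E" "e \<notin> var_monomials ?C"
      have "Poly_Mapping.lookup e k \<le> Poly_Mapping.lookup w k" for k
      proof (cases "Poly_Mapping.lookup w k = 0")
        case True
        then have "Poly_Mapping.lookup e k = 0" using e(2) unfolding var_monomials_def by blast
        then show ?thesis by simp
      next
        case False
        then show ?thesis using sqf[OF e(1), of k] by simp
      qed
      then have "w \<in> U" unfolding U_def by (rule upset_le[OF e(1)])
      with wU show False by blast
    qed
    then obtain B where B: "minimal_cover E B" "B \<subseteq> ?C" by (rule ex_minimal_cover)
    then have "w \<in> ?S B" using w(1) by blast
    then obtain a b where "w = a + b" "a \<in> var_monomials B" unfolding sumset_def by blast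
    then show False using B(2) by (auto simp: var_monomials_def lookup_add)
  qed
  moreover have "m + w \<in> ?W" if "m \<in> var_monomials A" for m
  proof -
    obtain i where i: "i \<in> A" "Poly_Mapping.lookup m i \<noteq> 0"
      using \<open>m \<in> var_monomials A\<close> by (auto simp: var_monomials_def)
    have "m = Poly_Mapping.single i 1 + (m - Poly_Mapping.single i 1)"
      using i(2) by (intro poly_mapping_eqI) (auto simp: lookup_add lookup_minus lookup_single when_def)
    then have "m + w = (w + Poly_Mapping.single i 1) + (m - Poly_Mapping.single i 1)"
      by (metis add.assoc add.commute)
    then show ?thesis using up i(1) by (simp add: A_def)
  qed
  moreover have "B \<subset> A" using B not_min by blast
  ultimately show ?thesis using w(1) B(1) by (intro that[of w A B]) auto
qed

text \<open>A generator meeting \<open>B\<close> in a single variable, times a monomial free of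
  \<open>B\<close>, has degree at most 1 in the variables of \<open>B\<close>, whereas every
  monomial of the square has degree at least 2 there. So a multiplier of the ideal into its square
  has no monomial free of \<open>B\<close>.\<close>

lemma annihilator_subset_minimal_prime:
  fixes g :: "('n::finite, 'k::field) mpoly"
  assumes sqf: "\<And>m i. m \<in> E \<Longrightarrow> Poly_Mapping.lookup m i \<le> 1" and "E \<noteq> {}"
    and B: "minimal_cover E B"
    and g: "\<And>x. x \<in> supp_ideal (upset E) \<Longrightarrow> g * x \<in> supp_ideal (sumset (upset E) (upset E))"
  shows "g \<in> supp_ideal (var_monomials B)"
proof -
  have cov: "cover E B" using B by (simp add: minimal_cover_def)
  then obtain i where i: "i \<in> B" using \<open>E \<noteq> {}\<close> by (auto simp: cover_def var_monomials_def)
  obtain e where e: "e \<in> E" "\<And>j. j \<in> B \<Longrightarrow> j \<noteq> i \<Longrightarrow> Poly_Mapping.lookup e j = 0"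
    by (rule minimal_cover_private[OF B i]) blast
  have "m \<in> var_monomials B" if m: "m \<in> Poly_Mapping.keys g" for m
  proof (rule ccontr)
    assume mB: "m \<notin> var_monomials B"
    have "Poly_Mapping.lookup (g * monomial e) (e + m) = Poly_Mapping.lookup g m"
      using lookup_single_mult[of e 1 g m] by (simp add: monomial_def mult.commute)
    then have "e + m \<in> Poly_Mapping.keys (g * monomial e)" using m by (simp add: in_keys_iff)
    then have "e + m \<in> sumset (upset E) (upset E)"
      using g[of "monomial e"] upset_self[OF e(1)] by (auto simp: supp_ideal_def)
    then obtain a b where ab: "e + m = a + b" "a \<in> upset E" "b \<in> upset E"
      unfolding sumset_def by blast
    have lookup: "Poly_Mapping.lookup (a + b) j = Poly_Mapping.lookup e j" if "j \<in> B" for j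
      using mB that by (simp add: ab(1)[symmetric] lookup_add var_monomials_def)
    have pos: "Poly_Mapping.lookup c i \<noteq> 0" if c: "c \<in> upset E" "c = a \<or> c = b" for c
    proof -
      obtain j where j: "j \<in> B" "Poly_Mapping.lookup c j \<noteq> 0"
        using c(1) upset_subset_var_monomials[OF cov] by (auto simp: var_monomials_def)
      have "Poly_Mapping.lookup e j \<noteq> 0" using lookup[OF j(1)] j(2) c(2) by (auto simp: lookup_add)
      then have "j = i" using e(2)[OF j(1)] by auto
      then show ?thesis using j(2) by simp
    qed
    have "Poly_Mapping.lookup e i = Poly_Mapping.lookup a i + Poly_Mapping.lookup b i"
      using lookup[OF i] by (simp add: lookup_add)
    then show False using sqf[OF e(1), of i] pos[of a] pos[of b] ab by auto
  qed
  then show ?thesis by (auto simp: supp_ideal_def)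
qed

section \<open>Depth against dimension of the conormal module\<close>

theorem proposition3p2:
  fixes I :: "('n::finite, 'k::field) mpoly set"
  assumes "squarefree_monomial_ideal I"
    and "I \<noteq> {\<zero>\<^bsub>mpoly_ring\<^esub>}"
    and "I \<noteq> carrier mpoly_ring"
    and "cohen_macaulay (quotient_module (ideal_module mpoly_ring I) (ideal_pow mpoly_ring I 2))"
  shows "ideal_pow mpoly_ring I 2 = symbolic_power mpoly_ring I 2 \<and>
    cohen_macaulay (quotient_module (ideal_module mpoly_ring I) (symbolic_power mpoly_ring I 2))"
proof -
  obtain E :: "('n \<Rightarrow>\<^sub>0 nat) set" where sqf: "\<And>m i. m \<in> E \<Longrightarrow> Poly_Mapping.lookup m i \<le> 1"
    and I_gen: "I = Idl\<^bsub>mpoly_ring\<^esub> (monomial ` E)"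
    using assms(1) unfolding squarefree_monomial_ideal_def by blast
  let ?U = "upset E"
  let ?W = "sumset ?U ?U"
  have I_eq: "I = supp_ideal ?U" unfolding I_gen by (rule genideal_monomials)
  define J where "J = ideal_pow mpoly_ring I 2"
  have J_eq: "J = supp_ideal ?W"
    unfolding J_def I_eq by (rule supp_ideal_pow_2[OF upclosed_upset])
  have I: "ideal I mpoly_ring" unfolding I_eq by (rule ideal_supp_ideal[OF upclosed_upset])
  have J: "ideal J mpoly_ring"
    unfolding J_eq by (rule ideal_supp_ideal[OF upclosed_sumset[OF upclosed_upset]])
  have "?W \<subseteq> ?U"
    unfolding sumset_def using upclosed_upset[of E] unfolding upclosed_def by blast
  then have sub: "J \<subseteq> I" by (auto simp: I_eq J_eq supp_ideal_def)
  have "E \<noteq> {}" using assms(2) by (auto simp: I_eq upset_def supp_ideal_def)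
  have "J = symbolic_power mpoly_ring I 2"
  proof
    have "J \<subseteq> ideal_pow mpoly_ring P 2" if P: "P \<in> minimal_primes mpoly_ring I" for P
    proof -
      have "ideal P mpoly_ring" "I \<subseteq> P"
        using P by (auto simp: minimal_primes_def primeideal_type_ring_iff)
      then show ?thesis
        unfolding J_def by (simp add: ideal_pow_2_eq I ideal_prod_mono)
    qed
    then show "J \<subseteq> symbolic_power mpoly_ring I 2" by (auto simp: symbolic_power_def)
    show "symbolic_power mpoly_ring I 2 \<subseteq> J"
    proof (rule subsetI, rule ccontr)
      fix p assume p: "p \<in> symbolic_power mpoly_ring I 2" "p \<notin> J"
      \<comment> \<open>The squares of the monomial primes are monomial ideals, so a single monomial
        of \<open>p\<close> outside the square of \<open>I\<close> still lies in all of
        them.\<close>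
      then obtain w0 where w0: "w0 \<in> Poly_Mapping.keys p" "w0 \<notin> ?W"
        by (auto simp: J_eq supp_ideal_def)
      have w0_sym: "w0 \<in> sumset (var_monomials B) (var_monomials B)" if B: "minimal_cover E B" for B
      proof -
        have "supp_ideal (var_monomials B) \<in> minimal_primes mpoly_ring I"
          unfolding I_eq by (rule minimal_prime_minimal_cover[OF sqf B])
        then have "p \<in> ideal_pow mpoly_ring (supp_ideal (var_monomials B)) 2"
          using p(1) unfolding symbolic_power_def by blast
        then have "p \<in> supp_ideal (sumset (var_monomials B) (var_monomials B))"
          unfolding supp_ideal_pow_2[OF upclosed_var_monomials] .
        then show ?thesis using w0(1) unfolding supp_ideal_def by blast
      qed
      obtain w A B where w: "w \<in> ?U" "w \<notin> ?W" "\<And>m. m \<in> var_monomials A \<Longrightarrow> m + w \<in> ?W"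
        and B: "minimal_cover E B" "B \<subset> A"
        using embedded_component[OF sqf w0(2) w0_sym] by metis
      let ?M = "quotient_module (ideal_module mpoly_ring I) J"
      have M: "module mpoly_ring ?M" "depth irrelevant_ideal ?M = module_dim mpoly_ring ?M"
        using assms(4) by (simp_all add: cohen_macaulay_def J_def)
      interpret ideal_quotient I J ?M by (rule ideal_quotient.intro[OF I J sub refl])
      have "depth irrelevant_ideal ?M \<le> card (- A)"
      proof (rule depth_ideal_quotient_le[OF I J sub M(1)])
        show "(monomial w :: ('n, 'k) mpoly) \<in> I" using w(1) by (simp add: I_eq)
        \<comment> \<open>The coefficient of \<open>g * monomial w\<close> at \<open>w\<close> is
          the constant term of \<open>g\<close>; were it nonzero, \<open>w\<close> would belong to
          \<open>?W\<close>.\<close>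
        show "g \<in> zero_const" if g: "g * monomial w \<in> J" for g
        proof (rule ccontr)
          assume "g \<notin> zero_const"
          moreover have "Poly_Mapping.lookup (g * monomial w) w = Poly_Mapping.lookup g 0"
            using lookup_single_mult[of w 1 g 0] by (simp add: monomial_def mult.commute)
          ultimately have "w \<in> Poly_Mapping.keys (g * monomial w)"
            by (simp add: zero_const_def in_keys_iff)
          then show False using g w(2) by (auto simp: J_eq supp_ideal_def)
        qed
        show "monomial m * monomial w \<in> J" if "i \<in> A" "Poly_Mapping.lookup m i \<noteq> 0" for m i
          using w(3)[of m] that by (auto simp: monomial_mult J_eq var_monomials_def)
      qed
      moreover have "card (- B) \<le> module_dim mpoly_ring ?M"
      proof -
        let ?K = "{a. \<forall>x\<in>I. a * x \<in> J}"
        have "ideal ?K mpoly_ring"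
          unfolding ideal_type_ring_iff
          using type_ideal_zero[OF J] type_ideal_add[OF J] type_ideal_mult[OF J]
          by (auto simp: distrib_right mult.assoc)
        moreover have "?K \<subseteq> supp_ideal (var_monomials B)"
          using annihilator_subset_minimal_prime[OF sqf \<open>E \<noteq> {}\<close> B(1)] by (auto simp: I_eq J_eq)
        ultimately have "card (- B) \<le> krull_dim (mpoly_ring Quot ?K)"
          by (rule krull_dim_quotient_ge_card)
        then show ?thesis by (simp add: module_dim_def annihilator_M)
      qed
      \<comment> \<open>Equality of depth and dimension links the two bounds, while \<open>B\<close>
        is a proper subset of \<open>A\<close>.\<close>
      ultimately have "enat (card (- B)) \<le> enat (card (- A))"
        using M(2) by (metis order_trans)
      moreover have "card (- A) < card (- B)" using B(2) by (intro psubset_card_mono) auto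
      ultimately show False by simp
    qed
  qed
  then show ?thesis using assms(4) unfolding J_def by simp
qed

end
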